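(* Fix a universal constant $C>0$, a sequence of positive integers $(D_n)_{n\in\mathbb N}$ with $D_n\le n^{C}$, and a sequence of positive reals $(A_n)_{n\in\mathbb N}$. Consider a Gaussian additive model with prior $P_0=P_0^{(n)}$ on $\mathbb R^n$; let $X,X'$ be i.i.d. from $P_0$, and suppose that the overlap $\langle X,X'\rangle$ has a differentiable density, denoted $t\mapsto \mathbb P(\langle X,X'\rangle=t)$. Assume: (1) for every multi-index $\alpha\in\mathbb Z_{\ge 0}^n$ with $|\alpha|\le D_n$, the joint cumulant satisfies $\kappa_\alpha(X_1,\dots,X_n)\ge 0$; (2) there exists a universal constant $\phi>0$ such that for all $i\in[n]$ the marginal $X_i$ is sub-Weibull of order $\phi$; (3) there exists a universal constant $C_1>0$ such that for all $n$, $q(D_n(\log n)^2)\ge \max\{(\log n)^{-D_n/2},\,n^{-C_1}\}$; (4) $\displaystyle \frac{d}{dt}\log \mathbb P(\langle X,X'\rangle=t)\Big|_{t=q(D_n)}\ \ge\ -\frac{A_n}{q(D_n(\log n)^2)\,\log n}$. For each $n$ let $D_n'$ be a positive integer, with $D_n'=(1+o(1))D_n\log^2 n$. Then for any $u>0$ satisfying $u+\frac{d}{dq}\mathcal F_{\mathrm{ann},u}(q)\big|_{q=q(D_n)}>0$, $$\mathrm{Corr}^{\le D_n}_{P_0}\!\left(\frac1{A_n}\Big(u+\frac{d}{dq}\mathcal F_{\mathrm{ann},u}(q)\Big|_{q=q(D_n)}\Big)\right)^2\le 2\,q(D_n').$$ In particular, for any SNR $\lambda=\lambda_n>0$, if $n$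 is large enough, $\frac{d}{dq}\mathcal F_{\mathrm{ann},\lambda}(q)\big|_{q=q(D_n)}\ge 0$ implies $\mathrm{Corr}^{\le D_n}_{P_0}\big(\tfrac1{A_n}\lambda\big)^2\le 2q(D_n')$.
   Context: Gaussian additive model (GAM) with prior $P_0$ on $\mathbb R^n$ and signal-to-noise ratio (SNR) $\lambda>0$: one observes $Y=\sqrt\lambda X+Z$ with $X\sim P_0$ and independent $Z\sim N(0,I_n)$. Low-degree correlation: $\mathbb R[Y]_{\le D}$ is the space of polynomials in $Y$ of total degree at most $D$, and $$\mathrm{Corr}^{\le D}_{P_0}(\lambda):=\sqrt{\sum_{i=1}^n\ \sup_{g_i\in\mathbb R[Y]_{\le D},\ \mathbb E[g_i(Y)^2]=1}\mathbb E[g_i(Y)X_i]^2}.$$ Overlap quantile: for i.i.d. $X,X'\sim P_0$ and $D>0$, $q(D):=\inf\{y\in\mathbb R:\ \mathbb P(|\langle X,X'\rangle|\le y)\ge 1-e^{-D}\}$. Annealed Franz–Parisi (FP) potential: $\mathcal F_{\mathrm{ann},\lambda}(q):=-\log\mathbb E_{X,X'}\big[1_{\langle X,X'\rangle=q}\,e^{\lambda\langle X,X'\rangle}\big]$, which for an overlap with density means $\mathcal F_{\mathrm{ann},\lambda}(q)=-\lambda q-\log\mathbb P(\langle X,X'\rangle=q)$, where $\mathbb P(\langle X,X'\rangle=q)$ denotes the density of $\langle X,X'\rangle$ at $q$. Joint cumulant: for a multi-index $\alpha$, $|\alpha|=\sum_i\alpha_i$, and $\kappa_\alpha(X_1,\dots,X_n)$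 is the joint cumulant of the collection containing $\alpha_i$ copies of $X_i$ for each $i$ (equal to $0$ for $\alpha=0$). Sub-Weibull: a real random variable $X$ is sub-Weibull of order $\phi>0$ if there exist constants $K>0$, $C_\phi\in(0,\infty)$ with $(\mathbb E|X|^p)^{1/p}\le C_\phi K p^{1/\phi}$ for all $p\ge1$.
   Formalization: The proved version assumes D_n' ≥ D_n log² n for all large n (the claim fails for D_n' slightly smaller), takes the sub-Weibull constants K, C_φ uniform in n and i, assumes the overlap density is positive at q(D_n), and asserts both bounds for all large n. *)

theory Defs
  imports "HOL-Probability.Probability" "HOL-Library.Disjoint_Sets"
begin

text \<open>
  As the dimension \<open>n\<close> varies inside the theorem, vectors of \<open>\<real>\<^sup>n\<close> are functions
  \<open>nat \<Rightarrow> real\<close> with coordinates \<open>0, \<dots>, n - 1\<close>, and a prior on \<open>\<real>\<^sup>n\<close> is a probability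
  measure on the product sigma-algebra over the index set \<open>{..<n}\<close>.
\<close>

definition is_prior :: "nat \<Rightarrow> (nat \<Rightarrow> real) measure \<Rightarrow> bool" where
  "is_prior n P \<longleftrightarrow> prob_space P \<and> sets P = sets (Pi\<^sub>M {..<n} (\<lambda>_. borel))"

text \<open>Joint law of the signal \<open>X\<close> and the independent noise \<open>Z\<close>.\<close>

definition gam_measure ::
    "nat \<Rightarrow> (nat \<Rightarrow> real) measure \<Rightarrow> ((nat \<Rightarrow> real) \<times> (nat \<Rightarrow> real)) measure" where
  "gam_measure n P = P \<Otimes>\<^sub>M Pi\<^sub>M {..<n} (\<lambda>_. std_normal_distribution)"

definition gam_obs :: "real \<Rightarrow> (nat \<Rightarrow> real) \<times> (nat \<Rightarrow> real) \<Rightarrow> nat \<Rightarrow> real" where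
  "gam_obs snr = (\<lambda>(x, z) i. sqrt snr * x i + z i)"

definition multi_indices :: "nat \<Rightarrow> nat \<Rightarrow> (nat \<Rightarrow> nat) set" where
  "multi_indices n D = {\<alpha>. (\<forall>i\<ge>n. \<alpha> i = 0) \<and> (\<Sum>i<n. \<alpha> i) \<le> D}"

definition polys_le :: "nat \<Rightarrow> nat \<Rightarrow> ((nat \<Rightarrow> real) \<Rightarrow> real) set" where
  "polys_le n D = {g. \<exists>c. g = (\<lambda>y. \<Sum>\<alpha>\<in>multi_indices n D. c \<alpha> * (\<Prod>i<n. y i ^ \<alpha> i))}"

text \<open>
  The supremum is taken in the reals.  It is meaningful for priors with finite second moments:
  the set contains the value of \<open>g = 1\<close>, and it is bounded by the second moment of \<open>X\<^sub>i\<close>.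
\<close>

definition low_deg_corr :: "nat \<Rightarrow> (nat \<Rightarrow> real) measure \<Rightarrow> nat \<Rightarrow> real \<Rightarrow> real" where
  "low_deg_corr n P D snr = sqrt (\<Sum>i<n.
     Sup {(\<integral>w. g (gam_obs snr w) * fst w i \<partial>gam_measure n P)\<^sup>2 | g.
            g \<in> polys_le n D \<and> (\<integral>w. (g (gam_obs snr w))\<^sup>2 \<partial>gam_measure n P) = 1})"

definition overlap :: "nat \<Rightarrow> (nat \<Rightarrow> real) \<times> (nat \<Rightarrow> real) \<Rightarrow> real" where
  "overlap n = (\<lambda>(x, x'). \<Sum>i<n. x i * x' i)"

text \<open>Only meaningful for \<open>D > 0\<close>; otherwise the set is not bounded below.\<close>

definition overlap_quantile :: "nat \<Rightarrow> (nat \<Rightarrow> real) measure \<Rightarrow> real \<Rightarrow> real" where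
  "overlap_quantile n P D =
     Inf {y. measure (P \<Otimes>\<^sub>M P) {w \<in> space (P \<Otimes>\<^sub>M P). \<bar>overlap n w\<bar> \<le> y} \<ge> 1 - exp (- D)}"

text \<open>
  The annealed Franz--Parisi potential of an overlap with density \<open>p\<close>; only meaningful at
  points where \<open>p\<close> is positive.
\<close>

definition fp_ann :: "(real \<Rightarrow> real) \<Rightarrow> real \<Rightarrow> real \<Rightarrow> real" where
  "fp_ann p snr q = - snr * q - ln (p q)"

text \<open>
  Joint cumulant of a finite family \<open>(X j)\<close>, \<open>j \<in> J\<close>, of random variables, by the partition formula
  (moments to cumulants), with value \<open>0\<close> for the empty family.
\<close>

definition joint_cumulant :: "'b measure \<Rightarrow> 'a set \<Rightarrow> ('a \<Rightarrow> 'b \<Rightarrow> real) \<Rightarrow> real" where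
  "joint_cumulant M J X = (if J = {} then 0 else
     (\<Sum>\<pi> | partition_on J \<pi>. (- 1) ^ (card \<pi> - 1) * fact (card \<pi> - 1) *
        (\<Prod>B\<in>\<pi>. \<integral>\<omega>. (\<Prod>j\<in>B. X j \<omega>) \<partial>M)))"

text \<open>The index \<open>(i, k)\<close> stands for the \<open>k\<close>-th copy of the coordinate \<open>X\<^sub>i\<close>.\<close>

definition cumulant :: "nat \<Rightarrow> (nat \<Rightarrow> real) measure \<Rightarrow> (nat \<Rightarrow> nat) \<Rightarrow> real" where
  "cumulant n P \<alpha> = joint_cumulant P (SIGMA i:{..<n}. {..<\<alpha> i}) (\<lambda>(i, k) x. x i)"

text \<open>
  Sub-Weibull of order \<open>\<phi>\<close>, with the constants exposed so that uniformity in the dimension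
  and in the coordinate can be stated.
\<close>

definition sub_weibull :: "real \<Rightarrow> real \<Rightarrow> real \<Rightarrow> 'b measure \<Rightarrow> ('b \<Rightarrow> real) \<Rightarrow> bool" where
  "sub_weibull \<phi> K C M X \<longleftrightarrow> (\<forall>p\<ge>1. integrable M (\<lambda>\<omega>. \<bar>X \<omega>\<bar> powr p) \<and>
     (\<integral>\<omega>. \<bar>X \<omega>\<bar> powr p \<partial>M) powr (1 / p) \<le> C * K * p powr (1 / \<phi>))"

end

theory Submission
  imports Defs
begin

text \<open>
  Since the slope of the Franz--Parisi potential at \<open>q(D)\<close> is minus the signal-to-noise ratio minus
  the logarithmic derivative of the overlap density, the hypotheses only say that the correlation is
  to be bounded at ratios \<open>\<lambda> \<le> 1 / (T log n)\<close>, where \<open>T = q(D log^2 n)\<close>.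

  By duality, \<open>E[g(Y) X\<^sub>i] = E[g(Y) w(Z)]\<close> for every polynomial \<open>g\<close> of degree at most \<open>D\<close>, where \<open>w\<close>
  is the Hermite series with coefficients \<open>\<lambda>^(|\<alpha>|/2) \<kappa>(\<alpha> + e\<^sub>i) / \<alpha>!\<close>.  By Cauchy--Schwarz the squared
  correlation is at most the sum of \<open>\<lambda>^|\<alpha>| \<kappa>(\<alpha> + e\<^sub>i)^2 / \<alpha>!\<close>.  Nonnegative cumulants of order at
  most \<open>D\<close> are at most the corresponding moments, and expressing the remaining ones of order \<open>D + 1\<close>
  through moments and lower cumulants gives in all cases
  \<open>\<kappa>(\<alpha> + e\<^sub>i)^2 \<le> 2^|\<alpha>| \<Sum>\<^sub>\<gamma> (\<alpha> choose \<gamma>) E[X\<^sub>i X^\<gamma>]^2 E[X^(\<alpha> - \<gamma>)]^2\<close>.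
  By the multinomial theorem the sum becomes a product of two truncated exponential series in the
  moments \<open>E\<langle>X, X'\<rangle>^k\<close>, \<open>k \<le> D + 1\<close>.  The event \<open>|\<langle>X, X'\<rangle>| > T\<close> has probability at most
  \<open>exp(- D log^2 n)\<close>, which beats the polynomial growth of the sub-Weibull moments, so these moments
  are at most \<open>1.01 T^k\<close>, and the product is at most \<open>1.01^2 T exp(4 \<lambda> T) \<le> 2 T\<close>.
\<close>

section \<open>Cumulants of set functions\<close>

text \<open>The moment-to-cumulant formula for an arbitrary set function, so that the combinatorics
  of partitions is separated from integration. On \<open>{}\<close> its value is 1 (from the empty
  partition), whereas \<open>joint_cumulant\<close> is 0 there; translations between the two
  therefore require a nonempty index set.\<close>

definition set_cumulant :: "('a set \<Rightarrow> real) \<Rightarrow> 'a set \<Rightarrow> real" where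
  "set_cumulant m J = (\<Sum>\<pi> | partition_on J \<pi>.
     (- 1) ^ (card \<pi> - 1) * fact (card \<pi> - 1) * (\<Prod>B\<in>\<pi>. m B))"

lemma partition_on_finite_blocks: "partition_on J \<pi> \<Longrightarrow> finite J \<Longrightarrow> finite \<pi>"
  using finite_elements by blast

text \<open>Exactly one block contains \<open>j\<close>. The count is the number of ways in which a
  given partition arises by adjoining a block that avoids \<open>j\<close>.\<close>

lemma card_blocks_avoiding:
  assumes "partition_on J \<pi>" "finite J" "j \<in> J"
  shows "card {C\<in>\<pi>. j \<notin> C} = card \<pi> - 1"
proof -
  obtain B where B: "B \<in> \<pi>" "j \<in> B"
    using assms partition_onD1 by fastforce
  have "{C\<in>\<pi>. j \<notin> C} = \<pi> - {B}"
    using B partition_onD2[OF assms(1)] by (auto simp: disjoint_def)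
  then show ?thesis
    using B partition_on_finite_blocks[OF assms(1,2)] by simp
qed

text \<open>Together with \<open>partition_on_remove_block\<close> this gives the bijection between
  partitions of proper subsets \<open>B\<close> of \<open>J\<close> and partitions of
  \<open>J\<close> with one marked block, the marked block being \<open>J - B\<close>. Properness
  makes that block nonempty.\<close>

lemma partition_on_insert_block:
  assumes "partition_on B \<pi>" "B \<subset> J"
  shows "partition_on J (insert (J - B) \<pi>)" and "J - B \<notin> \<pi>"
proof -
  have U: "\<Union>\<pi> = B" using assms(1) by (simp add: partition_on_def)
  show "J - B \<notin> \<pi>" using U assms(2) by blast
  show "partition_on J (insert (J - B) \<pi>)"
    using assms U unfolding partition_on_def pairwise_insert disjnt_def by blast
qed

lemma partition_on_remove_block:
  assumes "partition_on J \<pi>" "C \<in> \<pi>"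
  shows "partition_on (J - C) (\<pi> - {C})"
proof (rule partition_onI)
  show "\<Union> (\<pi> - {C}) = J - C"
    using partition_onD1[OF assms(1)] partition_onD2[OF assms(1)] assms(2)
    by (auto simp: disjoint_def)
  show "disjnt p q" if "p \<in> \<pi> - {C}" "q \<in> \<pi> - {C}" "p \<noteq> q" for p q
    using that partition_onD2[OF assms(1)] by (auto simp: pairwise_def)
  show "{} \<notin> \<pi> - {C}" using partition_onD3[OF assms(1)] by simp
qed

text \<open>Splitting off a block that avoids \<open>j\<close> shows that a partition with \<open>k\<close> blocks has total
  coefficient \<open>(-1)^(k-1) (k-1)! + (k-1) (-1)^(k-2) (k-2)! = 0\<close> on the right-hand side,
  unless \<open>k = 1\<close>.\<close>

lemma moment_eq_sum_set_cumulant: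
  fixes m :: "'a set \<Rightarrow> real"
  assumes fin: "finite J" and j: "j \<in> J" and m0: "m {} = 1"
  shows "m J = (\<Sum>B | j \<in> B \<and> B \<subseteq> J. set_cumulant m B * m (J - B))"
proof -
  define c :: "nat \<Rightarrow> real" where "c k = (- 1) ^ (k - 1) * fact (k - 1)" for k
  define w where "w \<pi> = (\<Prod>B\<in>\<pi>. m B)" for \<pi> :: "'a set set"
  have sc: "set_cumulant m B = (\<Sum>\<pi> | partition_on B \<pi>. c (card \<pi>) * w \<pi>)" for B
    unfolding set_cumulant_def c_def w_def ..
  have finp: "finite {\<pi>. partition_on B \<pi>}" if "B \<subseteq> J" for B
    using finitely_many_partition_on finite_subset[OF that fin] by blast
  \<comment> \<open>The set \<open>?S1\<close> indexes the expanded recursion without its term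
    \<open>B = J\<close>, and \<open>?S2\<close> indexes partitions of \<open>J\<close> with a
    marked block avoiding \<open>j\<close>. Passing from the first to the second adds one block,
    hence the coefficient \<open>c (card \<pi> - 1)\<close> on the second side.\<close>
  let ?S1 = "SIGMA B : {B. j \<in> B \<and> B \<subset> J}. {\<pi>. partition_on B \<pi>}"
  let ?S2 = "SIGMA \<pi> : {\<pi>. partition_on J \<pi>}. {C\<in>\<pi>. j \<notin> C}"
  have "(\<Sum>B | j \<in> B \<and> B \<subset> J. set_cumulant m B * m (J - B)) =
     (\<Sum>B | j \<in> B \<and> B \<subset> J. \<Sum>\<pi> | partition_on B \<pi>. c (card \<pi>) * w \<pi> * m (J - B))"
    by (simp add: sc sum_distrib_right)
  also have "\<dots> = (\<Sum>(B, \<pi>)\<in>?S1. c (card \<pi>) * w \<pi> * m (J - B))"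
    using fin finp by (subst sum.Sigma) (auto intro: finite_subset[of _ "Pow J"])
  also have "\<dots> = (\<Sum>(\<pi>, C)\<in>?S2. c (card \<pi> - 1) * w \<pi>)"
  proof (rule sum.reindex_bij_witness[of _ "\<lambda>(\<pi>, C). (J - C, \<pi> - {C})"
        "\<lambda>(B, \<pi>). (insert (J - B) \<pi>, J - B)"], goal_cases)
    case (1 a)
    then show ?case using partition_on_insert_block(2) by auto
  next
    case (2 a)
    then obtain B \<pi> where a: "a = (B, \<pi>)" "partition_on B \<pi>" "B \<subset> J" "j \<in> B" by auto
    then show ?case using partition_on_insert_block(1)[OF a(2,3)] by simp
  next
    case (3 b)
    then obtain \<pi> C where b: "b = (\<pi>, C)" "partition_on J \<pi>" "C \<in> \<pi>" "j \<notin> C" by auto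
    have "C \<subseteq> J" using b partition_onD1 by blast
    then have "J - (J - C) = C" by auto
    then show ?case using b by (simp add: insert_absorb)
  next
    case (4 b)
    then obtain \<pi> C where b: "b = (\<pi>, C)" "partition_on J \<pi>" "C \<in> \<pi>" "j \<notin> C" by auto
    have "C \<subseteq> J" "C \<noteq> {}" using b partition_onD1 partition_onD3 by blast+
    then show ?case using b partition_on_remove_block j by auto
  next
    case (5 a)
    then obtain B \<pi> where a: "a = (B, \<pi>)" "partition_on B \<pi>" "B \<subset> J" "j \<in> B" by auto
    have "finite \<pi>" using partition_on_finite_blocks a fin by (meson finite_subset psubset_imp_subset)
    then show ?case using a partition_on_insert_block(2)[OF a(2,3)]
      by (simp add: w_def)
  qed
  also have "\<dots> = (\<Sum>\<pi> | partition_on J \<pi>. \<Sum>C\<in>{C\<in>\<pi>. j \<notin> C}. c (card \<pi> - 1) * w \<pi>)"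
    using finp partition_on_finite_blocks[OF _ fin] by (subst sum.Sigma) auto
  also have "\<dots> = (\<Sum>\<pi> | partition_on J \<pi>. real (card \<pi> - 1) * c (card \<pi> - 1) * w \<pi>)"
    by (intro sum.cong refl) (simp add: card_blocks_avoiding[OF _ fin j])
  finally have proper: "(\<Sum>B | j \<in> B \<and> B \<subset> J. set_cumulant m B * m (J - B)) = \<dots>" .
  have "finite {B. j \<in> B \<and> B \<subset> J}"
    using fin by (auto intro: finite_subset[of _ "Pow J"])
  moreover have "{B. j \<in> B \<and> B \<subseteq> J} = insert J {B. j \<in> B \<and> B \<subset> J}" using j by auto
  ultimately have "(\<Sum>B | j \<in> B \<and> B \<subseteq> J. set_cumulant m B * m (J - B)) =
      set_cumulant m J + (\<Sum>B | j \<in> B \<and> B \<subset> J. set_cumulant m B * m (J - B))"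
    by (simp add: m0)
  also have "\<dots> = (\<Sum>\<pi> | partition_on J \<pi>.
      (c (card \<pi>) + real (card \<pi> - 1) * c (card \<pi> - 1)) * w \<pi>)"
    unfolding proper unfolding sc by (simp add: sum.distrib[symmetric] algebra_simps)
  also have "\<dots> = (\<Sum>\<pi> | partition_on J \<pi>. if \<pi> = {J} then m J else 0)"
  proof (intro sum.cong refl)
    fix \<pi> assume "\<pi> \<in> {\<pi>. partition_on J \<pi>}"
    then have p: "partition_on J \<pi>" by simp
    have f: "finite \<pi>" using partition_on_finite_blocks[OF p fin] .
    have "\<pi> \<noteq> {}" using p j by (auto simp: partition_on_def)
    then have "card \<pi> \<noteq> 0" using f by simp
    then consider "card \<pi> = 1" | k where "card \<pi> = Suc (Suc k)"
      by (metis One_nat_def not0_implies_Suc)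
    then show "(c (card \<pi>) + real (card \<pi> - 1) * c (card \<pi> - 1)) * w \<pi> = (if \<pi> = {J} then m J else 0)"
    proof cases
      case 1
      then obtain B where "\<pi> = {B}" using card_1_singletonE by blast
      moreover have "B = J" using p calculation by (auto simp: partition_on_def)
      ultimately show ?thesis by (simp add: c_def w_def)
    next
      case 2
      then have "\<pi> \<noteq> {J}" by auto
      moreover have "c (card \<pi>) + real (card \<pi> - 1) * c (card \<pi> - 1) = 0"
        unfolding 2 c_def by (simp add: algebra_simps)
      ultimately show ?thesis by simp
    qed
  qed
  also have "\<dots> = m J"
    using finp[OF order_refl] partition_on_space[of J] j by (subst sum.delta) auto
  finally show ?thesis ..
qed

lemma partition_on_image_bij:
  assumes "inj_on h J" "partition_on J \<pi>"
  shows "partition_on (h ` J) ((`) h ` \<pi>)"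
proof (rule partition_onI)
  have U: "\<And>B. B \<in> \<pi> \<Longrightarrow> B \<subseteq> J" "\<Union>\<pi> = J"
    using partition_onD1[OF assms(2)] by auto
  show "\<Union> ((`) h ` \<pi>) = h ` J" using U by blast
  show "disjnt p q" if pq: "p \<in> (`) h ` \<pi>" "q \<in> (`) h ` \<pi>" "p \<noteq> q" for p q
  proof -
    obtain B B' where B: "B \<in> \<pi>" "B' \<in> \<pi>" "p = h ` B" "q = h ` B'" using pq(1,2) by blast
    then have "B \<inter> B' = {}" using pq(3) partition_onD2[OF assms(2)] by (auto simp: disjoint_def)
    then show ?thesis
      using U(1)[OF B(1)] U(1)[OF B(2)] assms(1) B by (auto simp: disjnt_def dest: inj_onD)
  qed
  show "{} \<notin> (`) h ` \<pi>" using partition_onD3[OF assms(2)] by auto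
qed

text \<open>A bijection maps partitions to partitions with the same number of blocks and the same
  block values. This justifies renaming the labels that distinguish copies of one
  coordinate.\<close>

lemma set_cumulant_image:
  assumes inj: "inj_on h J" and m: "\<And>B. B \<subseteq> J \<Longrightarrow> m' (h ` B) = m B"
  shows "set_cumulant m' (h ` J) = set_cumulant m J"
proof -
  define g where "g = inv_into J h"
  have gh: "g ` h ` B = B" if "B \<subseteq> J" for B
    using that inj by (simp add: g_def)
  have hg: "h ` g ` B = B" if "B \<subseteq> h ` J" for B
    using that by (simp add: g_def image_inv_into_cancel)
  have injg: "inj_on g (h ` J)" unfolding g_def by (rule inj_on_inv_into) simp
  have sub: "B \<subseteq> A" if "partition_on A \<pi>" "B \<in> \<pi>" for A B and \<pi> :: "'x set set"
    using partition_onD1[OF that(1)] that(2) by auto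
  have injpi: "inj_on ((`) h) \<pi>" if "partition_on J \<pi>" for \<pi>
    by (rule inj_onI) (metis gh sub[OF that])
  show ?thesis unfolding set_cumulant_def
  proof (rule sum.reindex_bij_witness[symmetric, of _ "\<lambda>\<pi>. (`) g ` \<pi>" "\<lambda>\<pi>. (`) h ` \<pi>"], goal_cases)
    case (1 \<pi>)
    then show ?case using gh sub by (force simp: image_image)
  next
    case (2 \<pi>)
    then show ?case using partition_on_image_bij[OF inj] by simp
  next
    case (3 \<pi>)
    then show ?case using hg sub by (force simp: image_image)
  next
    case (4 \<pi>)
    then show ?case using partition_on_image_bij[OF injg, of \<pi>] gh[of J] by simp
  next
    case (5 \<pi>)
    then show ?case
      by (auto simp: card_image[OF injpi] prod.reindex[OF injpi] intro!: prod.cong m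
          dest: sub)
  qed
qed

section \<open>Cumulants indexed by multiplicities\<close>

definition mixed_moment :: "nat \<Rightarrow> (nat \<Rightarrow> real) measure \<Rightarrow> (nat \<Rightarrow> nat) \<Rightarrow> real" where
  "mixed_moment n P \<alpha> = (\<integral>x. (\<Prod>i<n. x i ^ \<alpha> i) \<partial>P)"

text \<open>A set of labelled copies \<open>(i, k)\<close> is read as a multiset of coordinates: the
  labels are forgotten and only the fibre sizes remain. Meaningful for finite fibres, since
  \<open>card\<close> is 0 on infinite sets.\<close>

definition multiplicities :: "(nat \<times> nat) set \<Rightarrow> nat \<Rightarrow> nat" where
  "multiplicities B i = card {k. (i, k) \<in> B}"

definition block_moment :: "(nat \<Rightarrow> real) measure \<Rightarrow> (nat \<times> nat) set \<Rightarrow> real" where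
  "block_moment P B = (\<integral>x. (\<Prod>j\<in>B. x (fst j)) \<partial>P)"

lemma cumulant_eq_set_cumulant:
  "(SIGMA i:{..<n}. {..<\<alpha> i}) \<noteq> {} \<Longrightarrow>
    cumulant n P \<alpha> = set_cumulant (block_moment P) (SIGMA i:{..<n}. {..<\<alpha> i})"
  by (simp add: cumulant_def joint_cumulant_def set_cumulant_def block_moment_def case_prod_beta)

lemma finite_fiber: "finite B \<Longrightarrow> finite {k. (i, k) \<in> B}"
  by (rule finite_subset[of _ "snd ` B"]) force+

lemma block_moment_eq:
  assumes "finite B" "B \<subseteq> {..<n} \<times> UNIV"
  shows "block_moment P B = mixed_moment n P (multiplicities B)"
proof -
  have B: "B = (SIGMA i:{..<n}. {k. (i, k) \<in> B})" using assms(2) by auto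
  have "(\<Prod>j\<in>B. x (fst j)) = (\<Prod>i<n. x i ^ multiplicities B i)" for x :: "nat \<Rightarrow> real"
    by (subst B, subst prod.Sigma[symmetric, where g = "\<lambda>j k. x j", unfolded case_prod_beta])
       (auto simp: finite_fiber[OF assms(1)] multiplicities_def)
  then show ?thesis by (simp add: block_moment_def mixed_moment_def)
qed

text \<open>The fibres of a subset of copies need not be initial segments, as the definition of
  \<open>cumulant\<close> requires. Renumbering each fibre in increasing order of an arbitrary
  enumeration brings them into that form, and neither moments nor set cumulants notice the
  relabelling.\<close>

lemma set_cumulant_block_moment:
  assumes fin: "finite B" and sub: "B \<subseteq> {..<n} \<times> UNIV" and ne: "B \<noteq> {}"
  shows "set_cumulant (block_moment P) B = cumulant n P (multiplicities B)"
proof -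
  have "\<exists>g. bij_betw g {k. (i, k) \<in> B} {0..<card {k. (i, k) \<in> B}}" for i
    by (rule ex_bij_betw_finite_nat[OF finite_fiber[OF fin]])
  then obtain g where g: "\<And>i. bij_betw (g i) {k. (i, k) \<in> B} {..<multiplicities B i}"
    unfolding multiplicities_def atLeast0LessThan by metis
  define h where "h = (\<lambda>(i, k). (i, g i k))"
  have inj: "inj_on h B"
    using g by (auto simp: h_def inj_on_def bij_betw_def)
  have im: "h ` B = (SIGMA i:{..<n}. {..<multiplicities B i})"
  proof (intro equalityI subsetI)
    fix y assume "y \<in> h ` B"
    then obtain i k where "(i, k) \<in> B" "y = (i, g i k)" by (auto simp: h_def)
    then show "y \<in> (SIGMA i:{..<n}. {..<multiplicities B i})"
      using sub g[of i] by (auto simp: bij_betw_def)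
  next
    fix y assume "y \<in> (SIGMA i:{..<n}. {..<multiplicities B i})"
    then obtain i l where y: "y = (i, l)" "l < multiplicities B i" by auto
    then have "l \<in> g i ` {k. (i, k) \<in> B}" using g[of i] by (simp add: bij_betw_def)
    then show "y \<in> h ` B" using y by (force simp: h_def)
  qed
  have "set_cumulant (block_moment P) (h ` B) = set_cumulant (block_moment P) B"
  proof (rule set_cumulant_image[OF inj])
    fix B' assume "B' \<subseteq> B"
    then have "inj_on h B'" using inj inj_on_subset by blast
    then show "block_moment P (h ` B') = block_moment P B'"
      unfolding block_moment_def by (subst prod.reindex) (simp_all add: h_def case_prod_beta)
  qed
  moreover have "cumulant n P (multiplicities B) = set_cumulant (block_moment P) (h ` B)"
    unfolding im by (rule cumulant_eq_set_cumulant) (use im ne in auto)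
  ultimately show ?thesis by simp
qed

definition inc :: "nat \<Rightarrow> (nat \<Rightarrow> nat) \<Rightarrow> nat \<Rightarrow> nat" where
  "inc i \<alpha> = \<alpha>(i := Suc (\<alpha> i))"

definition mchoose :: "nat \<Rightarrow> (nat \<Rightarrow> nat) \<Rightarrow> (nat \<Rightarrow> nat) \<Rightarrow> nat" where
  "mchoose n \<eta> \<alpha> = (\<Prod>i<n. \<eta> i choose \<alpha> i)"

lemma finite_lower_multi_indices:
  fixes \<eta> :: "nat \<Rightarrow> nat"
  assumes "\<forall>i\<ge>n. \<eta> i = 0"
  shows "finite {..\<eta>}"
proof -
  have le_sum: "\<eta> i \<le> (\<Sum>k<n. \<eta> k)" if "i < n" for i
    using that by (intro member_le_sum) auto
  have "{..\<eta>} \<subseteq> {f. \<forall>i. (i \<in> {..<n} \<longrightarrow> f i \<in> {..\<Sum>k<n. \<eta> k}) \<and> (i \<notin> {..<n} \<longrightarrow> f i = 0)}"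
  proof (intro subsetI CollectI allI conjI impI)
    fix f i assume f: "f \<in> {..\<eta>}"
    then have le: "f i \<le> \<eta> i" by (simp add: le_fun_def)
    show "f i \<in> {..\<Sum>k<n. \<eta> k}" if "i \<in> {..<n}"
      using le le_sum[of i] that by simp
    show "f i = 0" if "i \<notin> {..<n}"
      using le that assms by (simp add: not_less)
  qed
  then show ?thesis by (rule finite_subset) (intro finite_set_of_finite_funs, auto)
qed

text \<open>Copies are chosen independently in each fibre, hence a product of binomials. The support
  condition matches the fact that the sets counted have empty fibres beyond
  \<open>n\<close>.\<close>

lemma card_sub_multisets:
  fixes \<eta> \<alpha> :: "nat \<Rightarrow> nat"
  assumes "\<forall>i\<ge>n. \<alpha> i = 0"
  shows "card {S. S \<subseteq> (SIGMA i:{..<n}. {..<\<eta> i}) \<and> multiplicities S = \<alpha>} = mchoose n \<eta> \<alpha>"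
proof -
  let ?T = "PiE {..<n} (\<lambda>i. {T. T \<subseteq> {..<\<eta> i} \<and> card T = \<alpha> i})"
  have "bij_betw (\<lambda>T. SIGMA i:{..<n}. T i) ?T
      {S. S \<subseteq> (SIGMA i:{..<n}. {..<\<eta> i}) \<and> multiplicities S = \<alpha>}"
  proof (rule bij_betw_byWitness[where f' = "\<lambda>S. \<lambda>i\<in>{..<n}. {k. (i, k) \<in> S}"], goal_cases)
    case 1
    show ?case by (auto simp: fun_eq_iff PiE_def extensional_def)
  next
    case 2
    show ?case by (auto 4 4)
  next
    case 3
    have "multiplicities (SIGMA i:{..<n}. T i) = \<alpha>" if "T \<in> ?T" for T
    proof
      fix i
      show "multiplicities (SIGMA i:{..<n}. T i) i = \<alpha> i"
        using that assms by (cases "i < n") (auto simp: multiplicities_def PiE_iff)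
    qed
    then show ?case by (fastforce simp: PiE_iff)
  next
    case 4
    show ?case by (auto simp: multiplicities_def)
  qed
  then have "card {S. S \<subseteq> (SIGMA i:{..<n}. {..<\<eta> i}) \<and> multiplicities S = \<alpha>} = card ?T"
    by (simp add: bij_betw_same_card)
  also have "\<dots> = mchoose n \<eta> \<alpha>"
    by (simp add: card_PiE n_subsets mchoose_def)
  finally show ?thesis .
qed

text \<open>The partition recursion with the extra copy of \<open>X_i\<close> as distinguished
  element, after collecting blocks by multiplicity. It is the coefficient form of the identity M' =
  K' M between the moment generating function M = exp K and its logarithm K, with the derivative
  taken in direction \<open>i\<close>.\<close>

lemma mixed_moment_eq_sum_cumulant:
  fixes \<eta> :: "nat \<Rightarrow> nat"
  assumes P: "prob_space P" and supp: "\<forall>i\<ge>n. \<eta> i = 0" and i: "i < n"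
  shows "mixed_moment n P (inc i \<eta>) =
    (\<Sum>\<alpha>\<le>\<eta>. mchoose n \<eta> \<alpha> * cumulant n P (inc i \<alpha>) * mixed_moment n P (\<lambda>k. \<eta> k - \<alpha> k))"
proof -
  interpret prob_space P by fact
  let ?S = "SIGMA k:{..<n}. {..<\<eta> k}"
  \<comment> \<open>The copies of \<open>X_i\<close> in \<open>?S\<close> carry labels below
    \<open>\<eta> i\<close>, so the label \<open>\<eta> i\<close> is fresh.\<close>
  define j where "j = (i, \<eta> i)"
  define J where "J = insert j ?S"
  define F where "F \<alpha> = cumulant n P (inc i \<alpha>) * mixed_moment n P (\<lambda>k. \<eta> k - \<alpha> k)" for \<alpha>
  have finS: "finite ?S" by auto
  have j: "j \<notin> ?S" by (simp add: j_def)
  have mult_insert: "multiplicities (insert j S) = inc i (multiplicities S)" if "S \<subseteq> ?S" for S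
  proof
    fix k
    have f: "finite {l. (k, l) \<in> S}" by (rule finite_fiber[OF finite_subset[OF that finS]])
    have "{l. (k, l) \<in> insert j S} = (if k = i then insert (\<eta> i) {l. (k, l) \<in> S} else {l. (k, l) \<in> S})"
      by (auto simp: j_def)
    moreover have "\<eta> i \<notin> {l. (i, l) \<in> S}" using that by auto
    ultimately show "multiplicities (insert j S) k = inc i (multiplicities S) k"
      using f unfolding multiplicities_def inc_def by (cases "k = i") simp_all
  qed
  have mult_S: "multiplicities ?S = \<eta>"
  proof
    fix k
    show "multiplicities ?S k = \<eta> k"
      using supp by (cases "k < n") (simp_all add: multiplicities_def lessThan_def[symmetric])
  qed
  have mult_diff: "multiplicities (?S - S) = (\<lambda>k. \<eta> k - multiplicities S k)" if "S \<subseteq> ?S" for S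
  proof
    fix k
    have "{l. (k, l) \<in> ?S - S} = {l. (k, l) \<in> ?S} - {l. (k, l) \<in> S}" by auto
    moreover have "{l. (k, l) \<in> S} \<subseteq> {l. (k, l) \<in> ?S}" using that by auto
    ultimately have "multiplicities (?S - S) k = multiplicities ?S k - multiplicities S k"
      unfolding multiplicities_def
      by (metis card_Diff_subset finS finite_fiber finite_subset that)
    then show "multiplicities (?S - S) k = \<eta> k - multiplicities S k" by (simp add: mult_S)
  qed
  have subn: "S \<subseteq> {..<n} \<times> UNIV" if "S \<subseteq> J" for S
    using that i by (auto simp: J_def j_def)
  have finJ: "finite J" using finS by (simp add: J_def)
  have "mixed_moment n P (inc i \<eta>) = block_moment P J"
    using block_moment_eq[OF finJ subn] mult_insert mult_S by (simp add: J_def)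
  also have "\<dots> = (\<Sum>B | j \<in> B \<and> B \<subseteq> J. set_cumulant (block_moment P) B * block_moment P (J - B))"
    by (rule moment_eq_sum_set_cumulant)
       (use finJ in \<open>auto simp: J_def block_moment_def prob_space\<close>)
  also have "\<dots> = (\<Sum>S\<in>Pow ?S. set_cumulant (block_moment P) (insert j S) * block_moment P (?S - S))"
  proof (rule sum.reindex_bij_witness[of _ "\<lambda>S. insert j S" "\<lambda>B. B - {j}"], goal_cases)
    case (5 B)
    then have "insert j (B - {j}) = B" "?S - (B - {j}) = J - B" using j by (auto simp: J_def)
    then show ?case by simp
  qed (use j in \<open>auto simp: J_def\<close>)
  also have "\<dots> = (\<Sum>S\<in>Pow ?S. F (multiplicities S))"
  proof (rule sum.cong[OF refl])
    fix S assume S: "S \<in> Pow ?S"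
    then have "insert j S \<subseteq> J" "?S - S \<subseteq> J" by (auto simp: J_def)
    then show "set_cumulant (block_moment P) (insert j S) * block_moment P (?S - S) = F (multiplicities S)"
      using S finJ mult_insert[of S] mult_diff[of S] subn
      by (subst set_cumulant_block_moment, (auto intro: finite_subset)[3],
          subst block_moment_eq[of "?S - S" n]) (auto simp: F_def intro: finite_subset)
  qed
  \<comment> \<open>The summand depends on \<open>S\<close> only through its multiplicities, so each
    class contributes its cardinality, a product of binomials.\<close>
  also have "\<dots> = (\<Sum>\<alpha>\<le>\<eta>. \<Sum>S | S \<in> Pow ?S \<and> multiplicities S = \<alpha>. F (multiplicities S))"
  proof (rule sum.group[symmetric])
    show "multiplicities ` Pow ?S \<subseteq> {..\<eta>}"
    proof
      fix \<alpha> assume "\<alpha> \<in> multiplicities ` Pow ?S"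
      then obtain S where S: "S \<subseteq> ?S" "\<alpha> = multiplicities S" by auto
      have "multiplicities S k \<le> multiplicities ?S k" for k
        unfolding multiplicities_def
        by (rule card_mono[OF finite_fiber[OF finS]]) (use S in auto)
      then show "\<alpha> \<in> {..\<eta>}" using S by (simp add: mult_S le_fun_def)
    qed
  qed (use finS finite_lower_multi_indices[OF supp] in auto)
  also have "\<dots> = (\<Sum>\<alpha>\<le>\<eta>. mchoose n \<eta> \<alpha> * F \<alpha>)"
  proof (rule sum.cong[OF refl])
    fix \<alpha> assume "\<alpha> \<in> {..\<eta>}"
    then have "\<forall>i\<ge>n. \<alpha> i = 0" using supp by (auto simp: le_fun_def) (metis le_zero_eq)
    from card_sub_multisets[OF this, of \<eta>]
    show "(\<Sum>S | S \<in> Pow ?S \<and> multiplicities S = \<alpha>. F (multiplicities S)) = mchoose n \<eta> \<alpha> * F \<alpha>"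
      by simp
  qed
  finally show ?thesis by (simp add: F_def mult.assoc)
qed

section \<open>Hermite polynomials\<close>

lemma prod_sum_lower_multi_indices:
  fixes f :: "nat \<Rightarrow> nat \<Rightarrow> real"
  assumes "\<forall>i\<ge>n. \<beta> i = 0"
  shows "(\<Prod>i<n. \<Sum>k\<le>\<beta> i. f i k) = (\<Sum>\<alpha>\<le>\<beta>. \<Prod>i<n. f i (\<alpha> i))"
proof -
  have "(\<Prod>i<n. \<Sum>k\<le>\<beta> i. f i k) = (\<Sum>g\<in>PiE {..<n} (\<lambda>i. {..\<beta> i}). \<Prod>i<n. f i (g i))"
    by (rule prod_sum_PiE) auto
  also have "\<dots> = (\<Sum>\<alpha>\<le>\<beta>. \<Prod>i<n. f i (\<alpha> i))"
  \<comment> \<open>Functions in \<open>PiE\<close> are \<open>undefined\<close> beyond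
    \<open>n\<close>, while multi-indices are 0 there; the two witnesses exchange these default
    values.\<close>
  proof (rule sum.reindex_bij_witness[of _ "\<lambda>\<alpha>. restrict \<alpha> {..<n}" "\<lambda>g i. if i < n then g i else 0"], goal_cases)
    case (1 g)
    then show ?case by (auto simp: PiE_iff extensional_def)
  next
    case (3 \<alpha>)
    then have "\<alpha> i = 0" if "i \<ge> n" for i
      using that assms le_funD[of \<alpha> \<beta> i] by simp
    then show ?case by (auto simp: fun_eq_iff)
  next
    case (5 g)
    then show ?case by (auto intro!: prod.cong)
  qed (auto simp: le_fun_def PiE_iff)
  finally show ?thesis .
qed

lemma sum_mchoose:
  assumes "\<forall>i\<ge>n. \<beta> i = 0"
  shows "(\<Sum>\<alpha>\<le>\<beta>. real (mchoose n \<beta> \<alpha>)) = 2 ^ (\<Sum>i<n. \<beta> i)"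
proof -
  have "(\<Sum>\<alpha>\<le>\<beta>. real (mchoose n \<beta> \<alpha>)) = (\<Prod>i<n. \<Sum>k\<le>\<beta> i. real (\<beta> i choose k))"
    by (simp add: prod_sum_lower_multi_indices[OF assms] mchoose_def)
  also have "\<dots> = (\<Prod>i<n. 2 ^ \<beta> i)"
    by (intro prod.cong refl) (metis choose_row_sum of_nat_numeral of_nat_power of_nat_sum)
  finally show ?thesis by (simp add: power_sum)
qed

section \<open>Gaussian expectation of univariate polynomials\<close>

lemma prob_space_std_normal: "prob_space std_normal_distribution"
  by (rule prob_space_normal_density) simp

definition gauss :: "real poly \<Rightarrow> real" where
  "gauss p = (\<integral>z. poly p z \<partial>std_normal_distribution)"

lemma integrable_std_normal_power: "integrable std_normal_distribution (\<lambda>z. z ^ k)"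
  by (subst integrable_density) (auto simp: integrable_std_normal_moment)

lemma integrable_std_normal_abs_power: "integrable std_normal_distribution (\<lambda>z. \<bar>z\<bar> ^ k)"
  by (subst integrable_density) (auto simp: integrable_std_normal_moment_abs)

lemma integrable_std_normal_poly: "integrable std_normal_distribution (poly p)"
proof -
  have "integrable std_normal_distribution (\<lambda>z. \<Sum>i\<le>degree p. coeff p i * z ^ i)"
    by (intro Bochner_Integration.integrable_sum integrable_mult_right integrable_std_normal_power)
  then show ?thesis by (subst poly_altdef[abs_def]) simp
qed

lemma gauss_add: "gauss (p + q) = gauss p + gauss q"
  by (simp add: gauss_def integrable_std_normal_poly)

lemma gauss_diff: "gauss (p - q) = gauss p - gauss q"
  by (simp add: gauss_def integrable_std_normal_poly)

lemma gauss_smult: "gauss (smult c p) = c * gauss p"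
  by (simp add: gauss_def)

lemma gauss_0: "gauss 0 = 0"
  by (simp add: gauss_def)

lemma gauss_1: "gauss 1 = 1"
  using prob_space.prob_space[OF prob_space_std_normal] by (simp add: gauss_def)

lemma gauss_monom_eq: "gauss (monom 1 k) = (\<integral>z. z ^ k \<partial>std_normal_distribution)"
proof -
  have "poly (monom 1 k) = (\<lambda>z::real. z ^ k)" by (simp add: fun_eq_iff poly_monom)
  then show ?thesis by (simp add: gauss_def)
qed

lemma gauss_monom: "gauss (monom 1 k) = (\<integral>z. std_normal_density z * z ^ k \<partial>lborel)"
  by (simp add: gauss_monom_eq integral_density)

text \<open>Read off from the closed forms: even moments are (2l)! / (2^l l!) and odd ones vanish.
  This recursion is Stein's identity on monomials.\<close>

lemma gauss_monom_Suc_Suc: "gauss (monom 1 (Suc (Suc k))) = real (Suc k) * gauss (monom 1 k)"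
proof (cases "even k")
  case True
  then obtain l where l: "k = 2 * l" by blast
  have "fact (2 * Suc l) = real (2 * Suc l) * (real (Suc (2 * l)) * fact (2 * l))"
    by (simp add: algebra_simps)
  moreover have "2 ^ Suc l * fact (Suc l) = real (2 * Suc l) * (2 ^ l * fact l)"
    by simp
  moreover have ne: "real (2 * Suc l) \<noteq> 0" by simp
  ultimately have "fact (2 * Suc l) / (2 ^ Suc l * fact (Suc l)) =
      real (Suc (2 * l)) * (fact (2 * l) / (2 ^ l * fact l) :: real)"
    by (simp only: times_divide_eq_right mult_divide_mult_cancel_left[OF ne])
  moreover have "Suc (Suc k) = 2 * Suc l" by (simp add: l)
  ultimately show ?thesis
    unfolding gauss_monom l by (simp only: integral_std_normal_moment_even)
next
  case False
  then obtain l where l: "k = 2 * l + 1" using oddE by blast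
  have "Suc (Suc k) = 2 * Suc l + 1" by (simp add: l)
  then show ?thesis
    unfolding gauss_monom l by (simp only: integral_std_normal_moment_odd mult_zero_right)
qed

lemma gauss_pCons_monom: "gauss (pCons 0 (monom 1 k)) = gauss (pderiv (monom 1 k))"
proof (cases k)
  case 0
  have "gauss (monom 1 (Suc 0)) = 0"
    unfolding gauss_monom using integral_std_normal_moment_odd[of 0] by simp
  then show ?thesis using 0 by (simp add: monom_Suc pderiv_monom gauss_0)
next
  case (Suc l)
  have "pderiv (monom 1 k) = smult (real (Suc l)) (monom (1::real) l)"
    using Suc by (simp add: pderiv_monom smult_monom)
  then show ?thesis
    using gauss_monom_Suc_Suc[of l] Suc by (simp add: monom_Suc gauss_smult)
qed

text \<open>Stein's identity E[Z p(Z)] = E[p'(Z)], where \<open>pCons 0\<close> is multiplication by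
  the variable. Both sides are linear, so monomials suffice; the induction adds the terms of
  \<open>p\<close> one at a time.\<close>

lemma gauss_stein: "gauss (pCons 0 p) = gauss (pderiv p)"
proof -
  have "gauss (pCons 0 (\<Sum>i\<in>I. smult (coeff p i) (monom 1 i))) =
      gauss (pderiv (\<Sum>i\<in>I. smult (coeff p i) (monom 1 i)))" if "finite I" for I
    using that
  proof (induction I rule: finite_induct)
    case empty
    then show ?case by (simp add: gauss_0)
  next
    case (insert i I)
    have "gauss (pCons 0 (smult (coeff p i) (monom 1 i) + q)) =
        coeff p i * gauss (pCons 0 (monom 1 i)) + gauss (pCons 0 q)" for q
      by (simp flip: gauss_add gauss_smult)
    then show ?case
      using insert by (simp only: sum.insert not_False_eq_True pderiv_add pderiv_smult gauss_add gauss_smult gauss_pCons_monom)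
  qed
  from this[of "{..degree p}"] show ?thesis
    by (simp add: smult_monom poly_as_sum_of_monoms)
qed

text \<open>The probabilists' Hermite polynomials, given by the raising operator z - d/dz. This
  operator is the adjoint of differentiation under the Gaussian law, which is the only analytic
  property required of them.\<close>

fun hermite :: "nat \<Rightarrow> real poly" where
  "hermite 0 = 1"
| "hermite (Suc k) = pCons 0 (hermite k) - pderiv (hermite k)"

text \<open>Gaussian integration by parts: Stein's identity for \<open>p * hermite k\<close>
  produces two terms by the product rule, and the one containing \<open>pderiv (hermite k)\<close>
  cancels.\<close>

lemma gauss_hermite_Suc: "gauss (p * hermite (Suc k)) = gauss (pderiv p * hermite k)"
proof -
  have "p * hermite (Suc k) = pCons 0 (p * hermite k) - p * pderiv (hermite k)"
    by (simp add: right_diff_distrib)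
  then show ?thesis
    by (simp add: gauss_diff gauss_stein gauss_add pderiv_mult mult.commute)
qed

lemma pderiv_hermite: "pderiv (hermite (Suc k)) = smult (real (Suc k)) (hermite k)"
proof (induction k)
  case 0
  then show ?case by (simp add: pderiv_pCons)
next
  case (Suc k)
  have "pderiv (hermite (Suc (Suc k))) =
      hermite (Suc k) + pCons 0 (pderiv (hermite (Suc k))) - pderiv (pderiv (hermite (Suc k)))"
    by (simp add: pderiv_diff pderiv_pCons)
  also have "\<dots> = hermite (Suc k) + smult (real (Suc k)) (pCons 0 (hermite k) - pderiv (hermite k))"
    unfolding Suc by (simp add: pderiv_smult smult_diff_right del: hermite.simps)
  also have "\<dots> = smult (real (Suc (Suc k))) (hermite (Suc k))"
  proof -
    have "real (Suc (Suc k)) = 1 + real (Suc k)" by simp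
    then show ?thesis by (simp only: smult_add_left smult_1_left hermite.simps(2))
  qed
  finally show ?case .
qed

text \<open>One integration by parts followed by \<open>pderiv_hermite\<close> lowers both indices
  and yields the factor \<open>Suc i\<close>; when one index reaches 0 before the other, the
  derivative of the constant 1 kills the term.\<close>

lemma gauss_hermite_hermite: "gauss (hermite i * hermite j) = (if i = j then fact i else 0)"
proof (induction i arbitrary: j)
  case 0
  show ?case
    by (cases j) (simp_all only: gauss_hermite_Suc, simp_all add: gauss_1 gauss_0)
next
  case (Suc i)
  show ?case
  proof (cases j)
    case 0
    have "gauss (hermite 0 * hermite (Suc i)) = 0"
      by (simp only: gauss_hermite_Suc) (simp add: gauss_0)
    then show ?thesis using 0 by (simp add: mult.commute del: hermite.simps(2))
  next
    case (Suc k)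
    then show ?thesis
      using Suc.IH[of k] by (simp only: gauss_hermite_Suc pderiv_hermite) (simp add: gauss_smult)
  qed
qed

text \<open>Integrating by parts \<open>j\<close> times differentiates (s + z)^k \<open>j\<close>
  times, and the falling factorial that appears is j! times the binomial. For j > k both sides
  vanish, the right one through the binomial.\<close>

lemma gauss_shifted_power_hermite:
  "gauss ([:s, 1:] ^ k * hermite j) = fact j * real (k choose j) * gauss ([:s, 1:] ^ (k - j))"
proof (induction j arbitrary: k)
  case 0
  then show ?case by simp
next
  case (Suc j)
  show ?case
  proof (cases k)
    case 0
    then show ?thesis by (simp only: gauss_hermite_Suc) (simp add: gauss_0)
  next
    case (Suc l)
    have "pderiv ([:s, 1:] ^ k) = smult (real k) ([:s, 1:] ^ l)"
      unfolding Suc pderiv_power_Suc by (simp add: pderiv_pCons)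
    then have "gauss ([:s, 1:] ^ k * hermite (Suc j)) = real k * gauss ([:s, 1:] ^ l * hermite j)"
      by (simp only: gauss_hermite_Suc) (simp add: gauss_smult)
    also have "\<dots> = fact j * (real k * real (l choose j)) * gauss ([:s, 1:] ^ (l - j))"
      by (simp add: Suc.IH)
    also have "real k * real (l choose j) = real (Suc j) * real (k choose Suc j)"
      unfolding Suc by (metis Suc_times_binomial_eq of_nat_mult mult.commute)
    finally show ?thesis using Suc by (simp add: algebra_simps)
  qed
qed

section \<open>Random variables with moments of all orders\<close>

text \<open>Unlike integrability or square integrability, this class is closed under products as
  well as sums. Every integrability condition on polynomials in signal and noise then follows from
  the coordinates.\<close>

definition all_moments :: "'a measure \<Rightarrow> ('a \<Rightarrow> real) \<Rightarrow> bool" where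
  "all_moments M f \<longleftrightarrow> f \<in> borel_measurable M \<and> (\<forall>k::nat. integrable M (\<lambda>x. \<bar>f x\<bar> ^ k))"

lemma all_moments_measurable [measurable_dest]: "all_moments M f \<Longrightarrow> f \<in> borel_measurable M"
  by (simp add: all_moments_def)

lemma all_moments_integrable: "all_moments M f \<Longrightarrow> integrable M f"
  unfolding all_moments_def using integrable_abs_cancel[of M f] by (auto dest: spec[of _ "1::nat"])

lemma all_moments_const: "prob_space M \<Longrightarrow> all_moments M (\<lambda>_. c)"
  by (simp add: all_moments_def prob_space.finite_measure finite_measure.integrable_const)

lemma all_moments_mult:
  assumes f: "all_moments M f" and g: "all_moments M g"
  shows "all_moments M (\<lambda>x. f x * g x)"
  unfolding all_moments_def
proof (intro conjI allI)
  note [measurable] = f g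
  show "(\<lambda>x. f x * g x) \<in> borel_measurable M" by measurable
  fix k
  show "integrable M (\<lambda>x. \<bar>f x * g x\<bar> ^ k)"
  proof (rule Bochner_Integration.integrable_bound)
    show "integrable M (\<lambda>x. \<bar>f x\<bar> ^ (2 * k) + \<bar>g x\<bar> ^ (2 * k))"
      using f g unfolding all_moments_def by (intro Bochner_Integration.integrable_add) blast+
    show "(\<lambda>x. \<bar>f x * g x\<bar> ^ k) \<in> borel_measurable M" by measurable
    have "a * b \<le> a\<^sup>2 + b\<^sup>2" if "a \<ge> 0" "b \<ge> 0" for a b :: real
    proof -
      have "0 \<le> a * b" using that by simp
      then show ?thesis using sum_squares_bound[of a b] unfolding mult.assoc by linarith
    qed
    from this[of "\<bar>f x\<bar> ^ k" "\<bar>g x\<bar> ^ k" for x]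
    show "AE x in M. norm (\<bar>f x * g x\<bar> ^ k) \<le> norm (\<bar>f x\<bar> ^ (2 * k) + \<bar>g x\<bar> ^ (2 * k))"
      by (simp add: abs_mult power_mult_distrib power_even_eq)
  qed
qed

lemma all_moments_add:
  assumes f: "all_moments M f" and g: "all_moments M g"
  shows "all_moments M (\<lambda>x. f x + g x)"
  unfolding all_moments_def
proof (intro conjI allI)
  note [measurable] = f g
  show "(\<lambda>x. f x + g x) \<in> borel_measurable M" by measurable
  fix k
  show "integrable M (\<lambda>x. \<bar>f x + g x\<bar> ^ k)"
  proof (rule Bochner_Integration.integrable_bound)
    show "integrable M (\<lambda>x. 2 ^ k * (\<bar>f x\<bar> ^ k + \<bar>g x\<bar> ^ k))"
      using f g unfolding all_moments_def
      by (intro integrable_mult_right Bochner_Integration.integrable_add) blast+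
    show "(\<lambda>x. \<bar>f x + g x\<bar> ^ k) \<in> borel_measurable M" by measurable
    have "\<bar>a + b\<bar> ^ k \<le> 2 ^ k * (\<bar>a\<bar> ^ k + \<bar>b\<bar> ^ k)" for a b :: real
    proof -
      have "\<bar>a + b\<bar> ^ k \<le> (2 * max \<bar>a\<bar> \<bar>b\<bar>) ^ k" by (intro power_mono) auto
      also have "\<dots> = 2 ^ k * max \<bar>a\<bar> \<bar>b\<bar> ^ k" by (simp add: power_mult_distrib)
      also have "max \<bar>a\<bar> \<bar>b\<bar> ^ k \<le> \<bar>a\<bar> ^ k + \<bar>b\<bar> ^ k" by (simp add: max_def)
      finally show ?thesis by simp
    qed
    then show "AE x in M. norm (\<bar>f x + g x\<bar> ^ k) \<le> norm (2 ^ k * (\<bar>f x\<bar> ^ k + \<bar>g x\<bar> ^ k))"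
      by (simp add: abs_mult)
  qed
qed

lemma all_moments_sum:
  assumes "prob_space M" "\<And>i. i \<in> I \<Longrightarrow> all_moments M (f i)"
  shows "all_moments M (\<lambda>x. \<Sum>i\<in>I. f i x)"
  using assms(2)
proof (induction I rule: infinite_finite_induct)
  case (insert i I)
  then show ?case using all_moments_add[of M "f i" "\<lambda>x. \<Sum>i\<in>I. f i x"] by simp
qed (use all_moments_const[OF assms(1), of 0] in simp_all)

lemma all_moments_prod:
  assumes "prob_space M" "\<And>i. i \<in> I \<Longrightarrow> all_moments M (f i)"
  shows "all_moments M (\<lambda>x. \<Prod>i\<in>I. f i x)"
  using assms(2)
proof (induction I rule: infinite_finite_induct)
  case (insert i I)
  then show ?case using all_moments_mult[of M "f i" "\<lambda>x. \<Prod>i\<in>I. f i x"] by simp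
qed (use all_moments_const[OF assms(1), of 1] in simp_all)

lemma all_moments_cmult: "prob_space M \<Longrightarrow> all_moments M f \<Longrightarrow> all_moments M (\<lambda>x. c * f x)"
  by (intro all_moments_mult all_moments_const)

lemma all_moments_power:
  assumes "prob_space M" "all_moments M f"
  shows "all_moments M (\<lambda>x. f x ^ k)"
  using all_moments_prod[OF assms(1), of "{..<k}" "\<lambda>_. f"] assms(2) by simp

lemma all_moments_poly:
  assumes "prob_space M" "all_moments M f"
  shows "all_moments M (\<lambda>x. poly p (f x))"
  unfolding poly_altdef
  by (intro all_moments_sum all_moments_cmult all_moments_power assms)

lemma all_moments_distr:
  assumes T: "T \<in> measurable M N" and f: "all_moments (distr M N T) f"
  shows "all_moments M (\<lambda>x. f (T x))"
proof -
  have [measurable]: "f \<in> borel_measurable N" using f by (simp add: all_moments_def)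
  note [measurable] = T
  have "integrable M (\<lambda>x. \<bar>f (T x)\<bar> ^ k)" for k :: nat
    using f integrable_distr_eq[OF T, of "\<lambda>x. \<bar>f x\<bar> ^ k"] by (simp add: all_moments_def)
  then show ?thesis by (simp add: all_moments_def)
qed

lemma all_moments_fst:
  assumes "prob_space N" "all_moments M f"
  shows "all_moments (M \<Otimes>\<^sub>M N) (\<lambda>w. f (fst w))"
  by (rule all_moments_distr[OF measurable_fst]) (simp add: prob_space.distr_pair_fst assms)

lemma all_moments_snd:
  assumes M: "prob_space M" and N: "prob_space N" and f: "all_moments N f"
  shows "all_moments (M \<Otimes>\<^sub>M N) (\<lambda>w. f (snd w))"
proof -
  interpret pair_sigma_finite M N
    using M N by (simp add: pair_sigma_finite_def prob_space_imp_sigma_finite)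
  have [measurable]: "f \<in> borel_measurable N" using f by (simp add: all_moments_def)
  have "integrable (M \<Otimes>\<^sub>M N) (\<lambda>w. \<bar>f (snd w)\<bar> ^ k)" for k
  proof -
    have "integrable (N \<Otimes>\<^sub>M M) (\<lambda>w. \<bar>f (fst w)\<bar> ^ k)"
      using all_moments_fst[OF M f] by (simp add: all_moments_def)
    then show ?thesis
      by (subst integrable_product_swap_iff[symmetric]) (simp add: case_prod_unfold)
  qed
  then show ?thesis by (simp add: all_moments_def)
qed

section \<open>Gaussian vectors and multivariate Hermite polynomials\<close>

abbreviation gauss_vec :: "nat \<Rightarrow> (nat \<Rightarrow> real) measure" where
  "gauss_vec n \<equiv> Pi\<^sub>M {..<n} (\<lambda>_. std_normal_distribution)"

lemma prob_space_gauss_vec: "prob_space (gauss_vec n)"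
  by (intro prob_space_PiM prob_space_std_normal)

lemma all_moments_gauss_vec:
  assumes "i < n"
  shows "all_moments (gauss_vec n) (\<lambda>z. z i)"
proof (rule all_moments_distr[where f = "\<lambda>z. z"])
  show "(\<lambda>z. z i) \<in> measurable (gauss_vec n) std_normal_distribution"
    using assms by (intro measurable_component_singleton) simp
  have "distr (gauss_vec n) std_normal_distribution (\<lambda>z. z i) = std_normal_distribution"
    using assms distr_PiM_component[of "{..<n}" "\<lambda>_. std_normal_distribution" i] prob_space_std_normal by simp
  then show "all_moments (distr (gauss_vec n) std_normal_distribution (\<lambda>z. z i)) (\<lambda>z. z)"
    by (simp add: all_moments_def integrable_std_normal_abs_power)
qed

lemma integral_gauss_vec_prod:
  "(\<integral>z. (\<Prod>i<n. poly (p i) (z i)) \<partial>gauss_vec n) = (\<Prod>i<n. gauss (p i))"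
proof -
  interpret product_sigma_finite "\<lambda>_::nat. std_normal_distribution"
    by (simp add: product_sigma_finite_def prob_space_imp_sigma_finite prob_space_std_normal)
  show ?thesis unfolding gauss_def
    by (rule product_integral_prod) (auto simp: integrable_std_normal_poly)
qed

definition mhermite :: "nat \<Rightarrow> (nat \<Rightarrow> nat) \<Rightarrow> (nat \<Rightarrow> real) \<Rightarrow> real" where
  "mhermite n \<alpha> z = (\<Prod>i<n. poly (hermite (\<alpha> i)) (z i))"

definition mfact :: "nat \<Rightarrow> (nat \<Rightarrow> nat) \<Rightarrow> real" where
  "mfact n \<alpha> = (\<Prod>i<n. fact (\<alpha> i))"

definition mdeg :: "nat \<Rightarrow> (nat \<Rightarrow> nat) \<Rightarrow> nat" where
  "mdeg n \<alpha> = (\<Sum>i<n. \<alpha> i)"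

text \<open>The conditional moment of the observation given the signal \<open>x\<close>, that is
  E[\<Prod> (s x_i + Z_i)^(\<beta> i)] over the noise, factored by independence of the noise
  coordinates.\<close>

definition shifted_moment :: "nat \<Rightarrow> real \<Rightarrow> (nat \<Rightarrow> nat) \<Rightarrow> (nat \<Rightarrow> real) \<Rightarrow> real" where
  "shifted_moment n s \<beta> x = (\<Prod>i<n. gauss ([:s * x i, 1:] ^ \<beta> i))"

lemma mfact_pos: "mfact n \<alpha> > 0"
  by (simp add: mfact_def prod_pos)

lemma integral_mhermite_mhermite:
  assumes "\<forall>i\<ge>n. \<alpha> i = 0" "\<forall>i\<ge>n. \<beta> i = 0"
  shows "(\<integral>z. mhermite n \<alpha> z * mhermite n \<beta> z \<partial>gauss_vec n) = (if \<alpha> = \<beta> then mfact n \<alpha> else 0)"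
proof -
  have "(\<integral>z. mhermite n \<alpha> z * mhermite n \<beta> z \<partial>gauss_vec n) =
      (\<Prod>i<n. gauss (hermite (\<alpha> i) * hermite (\<beta> i)))"
    by (simp add: mhermite_def flip: prod.distrib poly_mult integral_gauss_vec_prod)
  also have "\<dots> = (if \<alpha> = \<beta> then mfact n \<alpha> else 0)"
  proof (cases "\<alpha> = \<beta>")
    case False
    then obtain i where "\<alpha> i \<noteq> \<beta> i" by auto
    moreover from this have "i < n" using assms by (metis not_less)
    ultimately show ?thesis using False by (auto simp: gauss_hermite_hermite intro!: prod_zero)
  qed (simp add: mfact_def gauss_hermite_hermite)
  finally show ?thesis .
qed

lemma integral_shifted_power_mhermite:
  fixes s :: real
  shows "(\<integral>z. (\<Prod>i<n. (s * x i + z i) ^ \<beta> i) * mhermite n \<alpha> z \<partial>gauss_vec n) =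
     mfact n \<alpha> * mchoose n \<beta> \<alpha> * shifted_moment n s (\<lambda>i. \<beta> i - \<alpha> i) x"
proof -
  have "(\<integral>z. (\<Prod>i<n. (s * x i + z i) ^ \<beta> i) * mhermite n \<alpha> z \<partial>gauss_vec n) =
      (\<Prod>i<n. gauss ([:s * x i, 1:] ^ \<beta> i * hermite (\<alpha> i)))"
    by (simp add: mhermite_def flip: prod.distrib integral_gauss_vec_prod)
  then show ?thesis
    by (simp add: gauss_shifted_power_hermite prod.distrib mfact_def mchoose_def shifted_moment_def)
qed

lemma integral_shifted_power:
  fixes s :: real
  shows "(\<integral>z. (\<Prod>i<n. (s * x i + z i) ^ \<beta> i) \<partial>gauss_vec n) = shifted_moment n s \<beta> x"
  using integral_shifted_power_mhermite[where s = s and x = x and \<beta> = \<beta> and n = n and \<alpha> = "\<lambda>_. 0"]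
  by (simp add: mhermite_def mfact_def mchoose_def)

lemma gauss_shifted_power:
  "gauss ([:t, 1:] ^ k) = (\<Sum>j\<le>k. real (k choose j) * t ^ j * gauss (monom 1 (k - j)))"
proof -
  have "gauss ([:t, 1:] ^ k) = (\<integral>z. (\<Sum>j\<le>k. real (k choose j) * t ^ j * z ^ (k - j)) \<partial>std_normal_distribution)"
    by (simp add: gauss_def binomial_ring)
  also have "\<dots> = (\<Sum>j\<le>k. real (k choose j) * t ^ j * gauss (monom 1 (k - j)))"
    by (subst Bochner_Integration.integral_sum)
       (simp_all add: gauss_monom_eq integrable_std_normal_power)
  finally show ?thesis .
qed

text \<open>Expanding in powers of the signal separates moments of \<open>x\<close> from Gaussian
  moments, so that integration over the prior involves only mixed moments of the signal.\<close>

lemma shifted_moment_eq: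
  fixes s :: real
  assumes "\<forall>i\<ge>n. \<beta> i = 0"
  shows "shifted_moment n s \<beta> x = (\<Sum>\<eta>\<le>\<beta>. mchoose n \<beta> \<eta> * s ^ mdeg n \<eta> *
    (\<Prod>i<n. gauss (monom 1 (\<beta> i - \<eta> i))) * (\<Prod>i<n. x i ^ \<eta> i))"
proof -
  have "shifted_moment n s \<beta> x =
     (\<Sum>\<eta>\<le>\<beta>. \<Prod>i<n. real (\<beta> i choose \<eta> i) * (s * x i) ^ \<eta> i * gauss (monom 1 (\<beta> i - \<eta> i)))"
    unfolding shifted_moment_def gauss_shifted_power by (rule prod_sum_lower_multi_indices[OF assms])
  then show ?thesis
    by (simp add: prod.distrib power_mult_distrib mchoose_def mdeg_def power_sum mult_ac)
qed

text \<open>Trinomial revision in each coordinate; it moves the dependence on the intermediate index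
  \<open>\<eta>\<close> so that the two orders of summation in the duality identity can be
  matched.\<close>

lemma mchoose_mult:
  assumes "\<alpha> \<le> \<eta>" "\<eta> \<le> \<beta>"
  shows "mchoose n \<beta> \<eta> * mchoose n \<eta> \<alpha> = mchoose n \<beta> \<alpha> * mchoose n (\<lambda>i. \<beta> i - \<alpha> i) (\<lambda>i. \<eta> i - \<alpha> i)"
  unfolding mchoose_def prod.distrib[symmetric]
  using assms by (intro prod.cong refl choose_mult) (auto simp: le_fun_def)

text \<open>The substitution \<eta> = \<alpha> + \<gamma>: pairs with \<alpha> + \<gamma> \<le>
  \<beta> are listed by their sum.\<close>

lemma sum_lower_multi_indices_swap:
  fixes f :: "(nat \<Rightarrow> nat) \<Rightarrow> (nat \<Rightarrow> nat) \<Rightarrow> real"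
  assumes "\<forall>i\<ge>n. \<beta> i = 0"
  shows "(\<Sum>\<alpha>\<le>\<beta>. \<Sum>\<gamma>\<le>(\<lambda>i. \<beta> i - \<alpha> i). f \<alpha> \<gamma>) = (\<Sum>\<eta>\<le>\<beta>. \<Sum>\<alpha>\<le>\<eta>. f \<alpha> (\<lambda>i. \<eta> i - \<alpha> i))"
proof -
  have fin: "finite {..\<eta>}" if "\<eta> \<le> \<beta>" for \<eta>
    using finite_lower_multi_indices[OF assms] finite_subset[of "{..\<eta>}" "{..\<beta>}"] that by auto
  have fin': "finite {..(\<lambda>i. \<beta> i - \<alpha> i)}" for \<alpha>
    by (rule fin) (simp add: le_fun_def)
  have "(\<Sum>\<alpha>\<le>\<beta>. \<Sum>\<gamma>\<le>(\<lambda>i. \<beta> i - \<alpha> i). f \<alpha> \<gamma>) =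
      (\<Sum>(\<alpha>, \<gamma>)\<in>(SIGMA \<alpha>:{..\<beta>}. {..(\<lambda>i. \<beta> i - \<alpha> i)}). f \<alpha> \<gamma>)"
    using fin fin' by (subst sum.Sigma) auto
  also have "\<dots> = (\<Sum>(\<eta>, \<alpha>)\<in>(SIGMA \<eta>:{..\<beta>}. {..\<eta>}). f \<alpha> (\<lambda>i. \<eta> i - \<alpha> i))"
  proof (rule sum.reindex_bij_witness[of _ "\<lambda>(\<eta>, \<alpha>). (\<alpha>, \<lambda>i. \<eta> i - \<alpha> i)" "\<lambda>(\<alpha>, \<gamma>). (\<lambda>i. \<alpha> i + \<gamma> i, \<alpha>)"], goal_cases)
    case (2 a)
    then show ?case by (auto simp: le_fun_def) (metis Nat.le_diff_conv2 add.commute)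
  next
    case (4 b)
    then obtain \<eta> \<alpha> where b: "b = (\<eta>, \<alpha>)" "\<eta> \<le> \<beta>" "\<alpha> \<le> \<eta>" by auto
    moreover have "\<alpha> \<le> \<beta>" using b(2,3) by (rule order.trans[rotated])
    ultimately show ?case by (auto simp: le_fun_def intro: diff_le_mono)
  qed (auto simp: le_fun_def)
  also have "\<dots> = (\<Sum>\<eta>\<le>\<beta>. \<Sum>\<alpha>\<le>\<eta>. f \<alpha> (\<lambda>i. \<eta> i - \<alpha> i))"
    using fin by (subst sum.Sigma) auto
  finally show ?thesis .
qed

section \<open>Duality for the low-degree correlation\<close>

lemma finite_multi_indices: "finite (multi_indices n D)"
proof (rule finite_subset)
  show "multi_indices n D \<subseteq> {..(\<lambda>i. if i < n then D else 0)}"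
  proof (intro subsetI)
    fix \<alpha> assume \<alpha>: "\<alpha> \<in> multi_indices n D"
    have "\<alpha> i \<le> D" if "i < n" for i
      using that \<alpha> member_le_sum[of i "{..<n}" \<alpha>] by (auto simp: multi_indices_def)
    then show "\<alpha> \<in> {..(\<lambda>i. if i < n then D else 0)}"
      using \<alpha> by (auto simp: le_fun_def multi_indices_def)
  qed
  show "finite {..(\<lambda>i. if i < n then D else 0 :: nat)}"
    by (rule finite_lower_multi_indices[of n]) simp
qed

lemma multi_indices_supp: "\<alpha> \<in> multi_indices n D \<Longrightarrow> \<forall>i\<ge>n. \<alpha> i = 0"
  by (simp add: multi_indices_def)

lemma multi_indices_downward:
  assumes "\<beta> \<in> multi_indices n D" "\<alpha> \<le> \<beta>"
  shows "\<alpha> \<in> multi_indices n D"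
proof -
  have "(\<Sum>i<n. \<alpha> i) \<le> (\<Sum>i<n. \<beta> i)" using assms(2) by (intro sum_mono) (simp add: le_fun_def)
  moreover have "\<alpha> i = 0" if "i \<ge> n" for i
    using assms that le_funD[of \<alpha> \<beta> i] by (simp add: multi_indices_def)
  ultimately show ?thesis using assms(1) by (auto simp: multi_indices_def)
qed

lemma prod_power_inc:
  fixes x :: "nat \<Rightarrow> real"
  assumes "i < n"
  shows "(\<Prod>k<n. x k ^ inc i \<eta> k) = x i * (\<Prod>k<n. x k ^ \<eta> k)"
proof -
  have "(\<Prod>k<n. x k ^ inc i \<eta> k) = (\<Prod>k<n. (if k = i then x i else 1) * x k ^ \<eta> k)"
    by (intro prod.cong) (auto simp: inc_def)
  then show ?thesis using assms by (simp add: prod.distrib)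
qed

text \<open>Only the existence of moments is built in; growth rates of the marginals are passed as
  hypotheses to the lemmas that use them.\<close>

locale moment_prior = prob_space P for P :: "(nat \<Rightarrow> real) measure" +
  fixes n :: nat
  assumes coord: "\<And>i. i < n \<Longrightarrow> all_moments P (\<lambda>x. x i)"
begin

lemma all_moments_monomial: "all_moments P (\<lambda>x. \<Prod>k<n. x k ^ \<eta> k)"
  by (intro all_moments_prod all_moments_power coord prob_space_axioms) simp

lemma integral_shifted_moment:
  fixes s :: real
  assumes "\<forall>i\<ge>n. \<beta> i = 0"
  shows "(\<integral>x. shifted_moment n s \<beta> x \<partial>P) = (\<Sum>\<eta>\<le>\<beta>. mchoose n \<beta> \<eta> * s ^ mdeg n \<eta> *
    (\<Prod>k<n. gauss (monom 1 (\<beta> k - \<eta> k))) * mixed_moment n P \<eta>)"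
  unfolding shifted_moment_eq[OF assms]
  by (subst Bochner_Integration.integral_sum)
     (auto simp: mixed_moment_def intro: all_moments_integrable[OF all_moments_monomial])

lemma integral_coord_shifted_moment:
  fixes s :: real
  assumes "\<forall>i\<ge>n. \<beta> i = 0" "i < n"
  shows "(\<integral>x. x i * shifted_moment n s \<beta> x \<partial>P) = (\<Sum>\<eta>\<le>\<beta>. mchoose n \<beta> \<eta> * s ^ mdeg n \<eta> *
    (\<Prod>k<n. gauss (monom 1 (\<beta> k - \<eta> k))) * mixed_moment n P (inc i \<eta>))"
proof -
  have "x i * shifted_moment n s \<beta> x = (\<Sum>\<eta>\<le>\<beta>. mchoose n \<beta> \<eta> * s ^ mdeg n \<eta> *
    (\<Prod>k<n. gauss (monom 1 (\<beta> k - \<eta> k))) * (\<Prod>k<n. x k ^ inc i \<eta> k))" for x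
    by (simp add: shifted_moment_eq[OF assms(1)] prod_power_inc[OF assms(2)] sum_distrib_left mult_ac)
  then show ?thesis
    by (simp add: mixed_moment_def all_moments_integrable[OF all_moments_monomial])
qed

text \<open>In terms of the observation: E[X_i Y^\<beta>] is a combination of the
  E[Y^(\<beta> - \<alpha>)] with cumulants of X as coefficients. It holds because the
  moment-cumulant recursion can be inserted under the expansion in powers of the signal, the noise
  being independent of the signal.\<close>

lemma integral_coord_shifted_moment_cumulant:
  fixes s :: real
  assumes supp: "\<forall>i\<ge>n. \<beta> i = 0" and i: "i < n"
  shows "(\<integral>x. x i * shifted_moment n s \<beta> x \<partial>P) =
    (\<Sum>\<alpha>\<le>\<beta>. s ^ mdeg n \<alpha> * mchoose n \<beta> \<alpha> * cumulant n P (inc i \<alpha>) *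
       (\<integral>x. shifted_moment n s (\<lambda>k. \<beta> k - \<alpha> k) x \<partial>P))"
proof -
  define \<nu> where "\<nu> \<delta> = (\<Prod>k<n. gauss (monom 1 (\<delta> k)))" for \<delta> :: "nat \<Rightarrow> nat"
  define \<kappa> where "\<kappa> \<alpha> = cumulant n P (inc i \<alpha>)" for \<alpha>
  \<comment> \<open>The common summand of both double sums: \<open>\<alpha>\<close> is the order
    assigned to the cumulant and \<open>\<gamma>\<close> the remaining order in the signal.\<close>
  define f where "f \<alpha> \<gamma> = s ^ mdeg n \<alpha> * s ^ mdeg n \<gamma> * mchoose n \<beta> \<alpha> * mchoose n (\<lambda>k. \<beta> k - \<alpha> k) \<gamma>
    * \<kappa> \<alpha> * \<nu> (\<lambda>k. \<beta> k - \<alpha> k - \<gamma> k) * mixed_moment n P \<gamma>" for \<alpha> \<gamma>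
  have "(\<Sum>\<alpha>\<le>\<beta>. s ^ mdeg n \<alpha> * mchoose n \<beta> \<alpha> * \<kappa> \<alpha> * (\<integral>x. shifted_moment n s (\<lambda>k. \<beta> k - \<alpha> k) x \<partial>P)) =
     (\<Sum>\<alpha>\<le>\<beta>. \<Sum>\<gamma>\<le>(\<lambda>k. \<beta> k - \<alpha> k). f \<alpha> \<gamma>)"
  proof (intro sum.cong refl)
    fix \<alpha>
    have "\<forall>i\<ge>n. \<beta> i - \<alpha> i = 0" using supp by simp
    from integral_shifted_moment[OF this, where s = s]
    show "s ^ mdeg n \<alpha> * mchoose n \<beta> \<alpha> * \<kappa> \<alpha> * (\<integral>x. shifted_moment n s (\<lambda>k. \<beta> k - \<alpha> k) x \<partial>P) =
        (\<Sum>\<gamma>\<le>(\<lambda>k. \<beta> k - \<alpha> k). f \<alpha> \<gamma>)"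
      by (simp add: sum_distrib_left f_def \<nu>_def mult_ac)
  qed
  also have "\<dots> = (\<Sum>\<eta>\<le>\<beta>. \<Sum>\<alpha>\<le>\<eta>. f \<alpha> (\<lambda>k. \<eta> k - \<alpha> k))"
    by (rule sum_lower_multi_indices_swap[OF supp])
  also have "\<dots> = (\<Sum>\<eta>\<le>\<beta>. mchoose n \<beta> \<eta> * s ^ mdeg n \<eta> * \<nu> (\<lambda>k. \<beta> k - \<eta> k) * mixed_moment n P (inc i \<eta>))"
  proof (rule sum.cong[OF refl])
    fix \<eta> assume \<eta>: "\<eta> \<in> {..\<beta>}"
    have supp\<eta>: "\<forall>i\<ge>n. \<eta> i = 0" using \<eta> supp by (metis atMost_iff le_funD le_zero_eq)
    have "f \<alpha> (\<lambda>k. \<eta> k - \<alpha> k) = mchoose n \<beta> \<eta> * s ^ mdeg n \<eta> * \<nu> (\<lambda>k. \<beta> k - \<eta> k) *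
        (mchoose n \<eta> \<alpha> * \<kappa> \<alpha> * mixed_moment n P (\<lambda>k. \<eta> k - \<alpha> k))" if \<alpha>: "\<alpha> \<in> {..\<eta>}" for \<alpha>
    proof -
      have le: "\<alpha> k \<le> \<eta> k" "\<eta> k \<le> \<beta> k" for k using \<alpha> \<eta> by (auto simp: le_fun_def)
      have "mdeg n \<alpha> + mdeg n (\<lambda>k. \<eta> k - \<alpha> k) = mdeg n \<eta>"
        using le by (simp add: mdeg_def flip: sum.distrib)
      then have 1: "s ^ mdeg n \<alpha> * s ^ mdeg n (\<lambda>k. \<eta> k - \<alpha> k) = s ^ mdeg n \<eta>"
        by (simp flip: power_add)
      have 2: "(\<lambda>k. \<beta> k - \<alpha> k - (\<eta> k - \<alpha> k)) = (\<lambda>k. \<beta> k - \<eta> k)"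
        using le by (simp add: fun_eq_iff)
      have 3: "real (mchoose n \<beta> \<alpha>) * mchoose n (\<lambda>k. \<beta> k - \<alpha> k) (\<lambda>k. \<eta> k - \<alpha> k) =
          real (mchoose n \<beta> \<eta>) * mchoose n \<eta> \<alpha>"
        using mchoose_mult[of \<alpha> \<eta> \<beta> n] \<alpha> \<eta> by (simp flip: of_nat_mult)
      have "f \<alpha> (\<lambda>k. \<eta> k - \<alpha> k) = (s ^ mdeg n \<alpha> * s ^ mdeg n (\<lambda>k. \<eta> k - \<alpha> k)) *
          (real (mchoose n \<beta> \<alpha>) * mchoose n (\<lambda>k. \<beta> k - \<alpha> k) (\<lambda>k. \<eta> k - \<alpha> k)) *
          (\<kappa> \<alpha> * \<nu> (\<lambda>k. \<beta> k - \<eta> k) * mixed_moment n P (\<lambda>k. \<eta> k - \<alpha> k))"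
        unfolding f_def 2 by (simp only: mult_ac)
      then show ?thesis unfolding 1 3 by (simp only: mult_ac)
    qed
    then show "(\<Sum>\<alpha>\<le>\<eta>. f \<alpha> (\<lambda>k. \<eta> k - \<alpha> k)) =
        mchoose n \<beta> \<eta> * s ^ mdeg n \<eta> * \<nu> (\<lambda>k. \<beta> k - \<eta> k) * mixed_moment n P (inc i \<eta>)"
      by (simp add: mixed_moment_eq_sum_cumulant[OF prob_space_axioms supp\<eta> i] sum_distrib_left \<kappa>_def)
  qed
  also have "\<dots> = (\<integral>x. x i * shifted_moment n s \<beta> x \<partial>P)"
    by (simp add: integral_coord_shifted_moment[OF supp i] \<nu>_def)
  finally show ?thesis by (simp add: \<kappa>_def)
qed

text \<open>Testing against \<open>dual_poly\<close> evaluated at the noise reproduces the correlation with \<open>X\<^sub>i\<close> for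
  every polynomial of degree at most \<open>D\<close>.\<close>

definition dual_poly :: "nat \<Rightarrow> real \<Rightarrow> nat \<Rightarrow> (nat \<Rightarrow> real) \<Rightarrow> real" where
  "dual_poly D s i z =
     (\<Sum>\<alpha>\<in>multi_indices n D. s ^ mdeg n \<alpha> * cumulant n P (inc i \<alpha>) / mfact n \<alpha> * mhermite n \<alpha> z)"

lemma all_moments_mhermite: "all_moments (gauss_vec n) (mhermite n \<alpha>)"
  unfolding mhermite_def
  by (intro all_moments_prod all_moments_poly all_moments_gauss_vec prob_space_gauss_vec) simp

lemma all_moments_dual_poly: "all_moments (gauss_vec n) (dual_poly D s i)"
  unfolding dual_poly_def
  by (intro all_moments_sum all_moments_cmult all_moments_mhermite prob_space_gauss_vec)

text \<open>Parseval for the orthogonal family \<open>mhermite\<close>, whose squared norms are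
  \<open>mfact\<close>; one of the two factorials in the squared coefficients therefore
  survives.\<close>

lemma integral_dual_poly_sq:
  fixes s :: real
  shows "(\<integral>z. (dual_poly D s i z)\<^sup>2 \<partial>gauss_vec n) =
     (\<Sum>\<alpha>\<in>multi_indices n D. (s\<^sup>2) ^ mdeg n \<alpha> * (cumulant n P (inc i \<alpha>))\<^sup>2 / mfact n \<alpha>)"
proof -
  define c where "c \<alpha> = s ^ mdeg n \<alpha> * cumulant n P (inc i \<alpha>) / mfact n \<alpha>" for \<alpha>
  have int: "integrable (gauss_vec n) (\<lambda>z. mhermite n \<alpha> z * mhermite n \<beta> z)" for \<alpha> \<beta>
    by (intro all_moments_integrable all_moments_mult all_moments_mhermite)
  have "(\<integral>z. (dual_poly D s i z)\<^sup>2 \<partial>gauss_vec n) =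
     (\<integral>z. (\<Sum>\<alpha>\<in>multi_indices n D. \<Sum>\<beta>\<in>multi_indices n D. c \<alpha> * c \<beta> * (mhermite n \<alpha> z * mhermite n \<beta> z)) \<partial>gauss_vec n)"
    by (simp add: dual_poly_def power2_eq_square sum_product c_def[symmetric] mult_ac)
  also have "\<dots> = (\<Sum>\<alpha>\<in>multi_indices n D. \<Sum>\<beta>\<in>multi_indices n D. c \<alpha> * c \<beta> * (\<integral>z. mhermite n \<alpha> z * mhermite n \<beta> z \<partial>gauss_vec n))"
    by (simp add: int)
  also have "\<dots> = (\<Sum>\<alpha>\<in>multi_indices n D. \<Sum>\<beta>\<in>multi_indices n D. if \<beta> = \<alpha> then c \<alpha> * c \<alpha> * mfact n \<alpha> else 0)"
    by (intro sum.cong refl)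
       (auto simp: integral_mhermite_mhermite[OF multi_indices_supp multi_indices_supp])
  also have "\<dots> = (\<Sum>\<alpha>\<in>multi_indices n D. c \<alpha> * c \<alpha> * mfact n \<alpha>)"
    by (simp add: finite_multi_indices)
  also have "\<dots> = (\<Sum>\<alpha>\<in>multi_indices n D. (s\<^sup>2) ^ mdeg n \<alpha> * (cumulant n P (inc i \<alpha>))\<^sup>2 / mfact n \<alpha>)"
    using mfact_pos[of n]
    by (intro sum.cong refl) (simp add: c_def power2_eq_square power_mult_distrib less_imp_neq[THEN not_sym])
  finally show ?thesis .
qed

section \<open>Duality in the observation model\<close>

abbreviation obs_monomial :: "real \<Rightarrow> (nat \<Rightarrow> nat) \<Rightarrow> (nat \<Rightarrow> real) \<times> (nat \<Rightarrow> real) \<Rightarrow> real" where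
  "obs_monomial snr \<beta> w \<equiv> (\<Prod>k<n. gam_obs snr w k ^ \<beta> k)"

lemma prob_space_gam: "prob_space (gam_measure n P)"
proof -
  interpret N: prob_space "gauss_vec n" by (rule prob_space_gauss_vec)
  interpret pair_prob_space P "gauss_vec n" ..
  show ?thesis unfolding gam_measure_def by unfold_locales
qed

lemma all_moments_gam_coord: "i < n \<Longrightarrow> all_moments (gam_measure n P) (\<lambda>w. fst w i)"
  unfolding gam_measure_def by (intro all_moments_fst coord prob_space_gauss_vec)

lemma all_moments_gam_noise: "all_moments (gauss_vec n) f \<Longrightarrow> all_moments (gam_measure n P) (\<lambda>w. f (snd w))"
  unfolding gam_measure_def by (intro all_moments_snd prob_space_gauss_vec prob_space_axioms)

lemma all_moments_obs_monomial: "all_moments (gam_measure n P) (obs_monomial snr \<beta>)"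
proof (intro all_moments_prod all_moments_power prob_space_gam)
  fix k assume "k \<in> {..<n}"
  then have k: "k < n" by simp
  have "all_moments (gam_measure n P) (\<lambda>w. sqrt snr * fst w k + snd w k)"
    using k by (intro all_moments_add all_moments_cmult prob_space_gam all_moments_gam_coord
        all_moments_gam_noise[of "\<lambda>z. z k"] all_moments_gauss_vec)
  then show "all_moments (gam_measure n P) (\<lambda>w. gam_obs snr w k)"
    by (simp add: gam_obs_def case_prod_beta)
qed

lemma integral_gam:
  assumes "all_moments (gam_measure n P) f"
  shows "(\<integral>w. f w \<partial>gam_measure n P) = (\<integral>x. (\<integral>z. f (x, z) \<partial>gauss_vec n) \<partial>P)"
proof -
  interpret N: prob_space "gauss_vec n" by (rule prob_space_gauss_vec)
  interpret pair_prob_space P "gauss_vec n" ..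
  show ?thesis
    using integral_fst'[of f] all_moments_integrable[OF assms] unfolding gam_measure_def by simp
qed

text \<open>Integrating out the noise turns the Hermite component \<open>\<alpha>\<close> into a
  shifted moment of order \<beta> - \<alpha>, with a factor \<open>mfact n \<alpha>\<close> that
  cancels the denominator in \<open>dual_poly\<close>. What remains is the cumulant expansion of
  E[X_i Y^\<beta>].\<close>

lemma integral_obs_monomial_dual_poly:
  assumes \<beta>: "\<beta> \<in> multi_indices n D" and i: "i < n"
  shows "(\<integral>w. obs_monomial snr \<beta> w * dual_poly D (sqrt snr) i (snd w) \<partial>gam_measure n P) =
    (\<integral>w. obs_monomial snr \<beta> w * fst w i \<partial>gam_measure n P)"
proof -
  let ?s = "sqrt snr"
  have supp: "\<forall>i\<ge>n. \<beta> i = 0" using \<beta> by (rule multi_indices_supp)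
  define c where "c \<alpha> = ?s ^ mdeg n \<alpha> * cumulant n P (inc i \<alpha>)" for \<alpha>
  have int: "integrable (gam_measure n P) (\<lambda>w. obs_monomial snr \<beta> w * mhermite n \<alpha> (snd w))" for \<alpha>
    by (intro all_moments_integrable all_moments_mult all_moments_obs_monomial
        all_moments_gam_noise all_moments_mhermite)
  have one: "(\<integral>w. obs_monomial snr \<beta> w * mhermite n \<alpha> (snd w) \<partial>gam_measure n P) =
     mfact n \<alpha> * mchoose n \<beta> \<alpha> * (\<integral>x. shifted_moment n ?s (\<lambda>k. \<beta> k - \<alpha> k) x \<partial>P)" for \<alpha>
    by (subst integral_gam[OF all_moments_mult[OF all_moments_obs_monomial
            all_moments_gam_noise[OF all_moments_mhermite]]])
       (simp add: gam_obs_def integral_shifted_power_mhermite)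
  have "(\<integral>w. obs_monomial snr \<beta> w * dual_poly D ?s i (snd w) \<partial>gam_measure n P) =
     (\<Sum>\<alpha>\<in>multi_indices n D. c \<alpha> / mfact n \<alpha> * (\<integral>w. obs_monomial snr \<beta> w * mhermite n \<alpha> (snd w) \<partial>gam_measure n P))"
    using int by (simp add: dual_poly_def sum_distrib_left c_def mult.left_commute[of "obs_monomial snr \<beta> _"])
  also have "\<dots> = (\<Sum>\<alpha>\<in>multi_indices n D. c \<alpha> * mchoose n \<beta> \<alpha> * (\<integral>x. shifted_moment n ?s (\<lambda>k. \<beta> k - \<alpha> k) x \<partial>P))"
    unfolding one using mfact_pos[of n]
    by (intro sum.cong refl) (simp add: less_imp_neq[THEN not_sym])
  \<comment> \<open>The degree bound on \<open>\<beta>\<close> ensures that every \<alpha> \<le>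
    \<beta> occurs in \<open>dual_poly\<close>; all other indices contribute 0 through a vanishing
    binomial.\<close>
  also have "\<dots> = (\<Sum>\<alpha>\<le>\<beta>. c \<alpha> * mchoose n \<beta> \<alpha> * (\<integral>x. shifted_moment n ?s (\<lambda>k. \<beta> k - \<alpha> k) x \<partial>P))"
  proof (rule sum.mono_neutral_right[OF finite_multi_indices])
    show "{..\<beta>} \<subseteq> multi_indices n D" using multi_indices_downward[OF \<beta>] by blast
    show "\<forall>\<alpha>\<in>multi_indices n D - {..\<beta>}. c \<alpha> * mchoose n \<beta> \<alpha> * (\<integral>x. shifted_moment n ?s (\<lambda>k. \<beta> k - \<alpha> k) x \<partial>P) = 0"
    proof
      fix \<alpha> assume \<alpha>: "\<alpha> \<in> multi_indices n D - {..\<beta>}"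
      then obtain k where k: "\<beta> k < \<alpha> k" by (auto simp: le_fun_def not_le)
      then have "k < n" using multi_indices_supp[of \<alpha> n D] \<alpha> by (metis DiffD1 not_less not_less_zero)
      then have "mchoose n \<beta> \<alpha> = 0" using k unfolding mchoose_def by (intro prod_zero) (auto simp: binomial_eq_0)
      then show "c \<alpha> * mchoose n \<beta> \<alpha> * (\<integral>x. shifted_moment n ?s (\<lambda>k. \<beta> k - \<alpha> k) x \<partial>P) = 0" by simp
    qed
  qed
  also have "\<dots> = (\<integral>x. x i * shifted_moment n ?s \<beta> x \<partial>P)"
    unfolding integral_coord_shifted_moment_cumulant[OF supp i]
    by (intro sum.cong refl) (simp add: c_def)
  also have "\<dots> = (\<integral>w. obs_monomial snr \<beta> w * fst w i \<partial>gam_measure n P)"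
  proof -
    have "(\<integral>z. obs_monomial snr \<beta> (x, z) \<partial>gauss_vec n) = shifted_moment n ?s \<beta> x" for x
      by (simp add: gam_obs_def integral_shifted_power)
    then show ?thesis
      by (subst integral_gam[OF all_moments_mult[OF all_moments_obs_monomial all_moments_gam_coord[OF i]]])
         (simp add: mult.commute)
  qed
  finally show ?thesis .
qed

lemma low_deg_corr_coord_le:
  assumes g: "g \<in> polys_le n D" and i: "i < n" and snr: "snr \<ge> 0"
    and norm: "(\<integral>w. (g (gam_obs snr w))\<^sup>2 \<partial>gam_measure n P) = 1"
  shows "(\<integral>w. g (gam_obs snr w) * fst w i \<partial>gam_measure n P)\<^sup>2 \<le>
     (\<Sum>\<alpha>\<in>multi_indices n D. snr ^ mdeg n \<alpha> * (cumulant n P (inc i \<alpha>))\<^sup>2 / mfact n \<alpha>)"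
proof -
  let ?G = "gam_measure n P"
  obtain c where c: "g = (\<lambda>y. \<Sum>\<alpha>\<in>multi_indices n D. c \<alpha> * (\<Prod>i<n. y i ^ \<alpha> i))"
    using g by (auto simp: polys_le_def)
  define w where "w y = dual_poly D (sqrt snr) i (snd y)" for y :: "(nat \<Rightarrow> real) \<times> (nat \<Rightarrow> real)"
  have mw: "all_moments ?G w"
    unfolding w_def by (intro all_moments_gam_noise all_moments_dual_poly)
  have mg: "all_moments ?G (\<lambda>y. g (gam_obs snr y))"
    unfolding c by (intro all_moments_sum all_moments_cmult all_moments_obs_monomial prob_space_gam)
  define a where "a = (\<integral>y. g (gam_obs snr y) * w y \<partial>?G)"
  have "(\<integral>y. g (gam_obs snr y) * fst y i \<partial>?G) =
     (\<Sum>\<alpha>\<in>multi_indices n D. c \<alpha> * (\<integral>y. obs_monomial snr \<alpha> y * fst y i \<partial>?G))"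
    unfolding c sum_distrib_right mult.assoc
    by (subst Bochner_Integration.integral_sum)
       (auto intro!: all_moments_integrable all_moments_cmult all_moments_mult all_moments_obs_monomial
          all_moments_gam_coord i prob_space_gam)
  also have "\<dots> = (\<Sum>\<alpha>\<in>multi_indices n D. c \<alpha> * (\<integral>y. obs_monomial snr \<alpha> y * w y \<partial>?G))"
    using integral_obs_monomial_dual_poly[OF _ i] by (simp add: w_def)
  also have "\<dots> = a"
    unfolding c sum_distrib_right mult.assoc a_def
    by (subst Bochner_Integration.integral_sum)
       (auto intro!: all_moments_integrable all_moments_cmult all_moments_mult all_moments_obs_monomial
          mw prob_space_gam)
  finally have eq: "(\<integral>y. g (gam_obs snr y) * fst y i \<partial>?G) = a" .
  \<comment> \<open>Cauchy-Schwarz by projection: g has unit norm and \<open>a\<close> is its inner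
    product with \<open>w\<close>, so the residual has squared norm E[w^2] - a^2.\<close>
  have "0 \<le> (\<integral>y. (w y - a * g (gam_obs snr y))\<^sup>2 \<partial>?G)" by simp
  also have "\<dots> = (\<integral>y. (w y)\<^sup>2 - 2 * a * (g (gam_obs snr y) * w y) + a\<^sup>2 * (g (gam_obs snr y))\<^sup>2 \<partial>?G)"
    by (intro Bochner_Integration.integral_cong refl) (simp add: power2_eq_square algebra_simps)
  also have "\<dots> = (\<integral>y. (w y)\<^sup>2 \<partial>?G) - 2 * a * a + a\<^sup>2 * 1"
  proof -
    have "integrable ?G (\<lambda>y. (w y)\<^sup>2)" "integrable ?G (\<lambda>y. g (gam_obs snr y) * w y)"
      "integrable ?G (\<lambda>y. (g (gam_obs snr y))\<^sup>2)"
      by (intro all_moments_integrable all_moments_mult all_moments_power mw mg prob_space_gam)+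
    then show ?thesis by (simp add: norm a_def)
  qed
  finally have "a\<^sup>2 \<le> (\<integral>y. (w y)\<^sup>2 \<partial>?G)" by (simp add: power2_eq_square)
  also have "\<dots> = (\<integral>x. (\<integral>z. (dual_poly D (sqrt snr) i z)\<^sup>2 \<partial>gauss_vec n) \<partial>P)"
    by (subst integral_gam[OF all_moments_power[OF prob_space_gam mw]]) (simp add: w_def)
  also have "\<dots> = (\<Sum>\<alpha>\<in>multi_indices n D. snr ^ mdeg n \<alpha> * (cumulant n P (inc i \<alpha>))\<^sup>2 / mfact n \<alpha>)"
    using snr by (simp add: prob_space integral_dual_poly_sq)
  finally show ?thesis using eq by simp
qed

lemma low_deg_corr_sq_le:
  assumes snr: "snr \<ge> 0"
  shows "(low_deg_corr n P D snr)\<^sup>2 \<le>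
    (\<Sum>i<n. \<Sum>\<alpha>\<in>multi_indices n D. snr ^ mdeg n \<alpha> * (cumulant n P (inc i \<alpha>))\<^sup>2 / mfact n \<alpha>)"
proof -
  interpret G: prob_space "gam_measure n P" by (rule prob_space_gam)
  let ?S = "\<lambda>i. {(\<integral>w. g (gam_obs snr w) * fst w i \<partial>gam_measure n P)\<^sup>2 | g.
            g \<in> polys_le n D \<and> (\<integral>w. (g (gam_obs snr w))\<^sup>2 \<partial>gam_measure n P) = 1}"
  let ?B = "\<lambda>i. \<Sum>\<alpha>\<in>multi_indices n D. snr ^ mdeg n \<alpha> * (cumulant n P (inc i \<alpha>))\<^sup>2 / mfact n \<alpha>"
  have one: "(\<lambda>_. 1) \<in> polys_le n D"
  proof -
    have "(\<Sum>\<alpha>\<in>multi_indices n D. (if \<alpha> = (\<lambda>_. 0) then 1 else 0) * (\<Prod>i<n. y i ^ \<alpha> i)) = 1" for y :: "nat \<Rightarrow> real"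
    proof -
      have "(\<Sum>\<alpha>\<in>multi_indices n D. (if \<alpha> = (\<lambda>_. 0) then 1 else 0) * (\<Prod>i<n. y i ^ \<alpha> i)) =
          (\<Sum>\<alpha>\<in>multi_indices n D. if \<alpha> = (\<lambda>_. 0) then 1 else 0)"
        by (intro sum.cong) auto
      then show ?thesis by (simp add: finite_multi_indices) (simp add: multi_indices_def)
    qed
    then show ?thesis unfolding polys_le_def by (intro CollectI exI ext) (rule sym)
  qed
  \<comment> \<open>The constant polynomial 1 makes the set nonempty, and its value is a square.
    Together with the upper bound this gives \<open>Sup (?S i) \<ge> 0\<close>, so that squaring
    undoes the square root in \<open>low_deg_corr\<close>.\<close>
  have ex: "(\<integral>w. fst w i \<partial>gam_measure n P)\<^sup>2 \<in> ?S i" for i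
    using one G.prob_space by (intro CollectI exI[of _ "\<lambda>_. 1"]) simp
  have le: "y \<le> ?B i" if "y \<in> ?S i" "i < n" for y i
    using that low_deg_corr_coord_le[OF _ that(2) snr] by auto
  have Sup_le: "Sup (?S i) \<le> ?B i" if "i < n" for i
    using ex le[OF _ that] by (intro cSup_least) blast+
  have Sup_ge: "Sup (?S i) \<ge> 0" if "i < n" for i
  proof -
    have "bdd_above (?S i)" using le[OF _ that] by (rule bdd_aboveI)
    from cSup_upper[OF ex this] show ?thesis by (rule order.trans[rotated]) simp
  qed
  have "(low_deg_corr n P D snr)\<^sup>2 = (\<Sum>i<n. Sup (?S i))"
    unfolding low_deg_corr_def using Sup_ge by (intro real_sqrt_pow2 sum_nonneg) simp
  also have "\<dots> \<le> (\<Sum>i<n. ?B i)" by (intro sum_mono Sup_le) simp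
  finally show ?thesis .
qed

end

section \<open>Reduction to moments of the overlap\<close>

lemma sum_multi_indices_Suc:
  fixes f :: "(nat \<Rightarrow> nat) \<Rightarrow> real"
  shows "(\<Sum>\<beta>\<in>multi_indices (Suc n) D. f \<beta>) = (\<Sum>j\<le>D. \<Sum>\<gamma>\<in>multi_indices n (D - j). f (\<gamma>(n := j)))"
proof -
  have sum_upd: "(\<Sum>i<n. (\<beta>(n := j)) i) = (\<Sum>i<n. \<beta> i)" for \<beta> :: "nat \<Rightarrow> nat" and j
    by (intro sum.cong) auto
  have "(\<Sum>\<beta>\<in>multi_indices (Suc n) D. f \<beta>) = (\<Sum>(j, \<gamma>)\<in>(SIGMA j:{..D}. multi_indices n (D - j)). f (\<gamma>(n := j)))"
  proof (rule sum.reindex_bij_witness[of _ "\<lambda>(j, \<gamma>). \<gamma>(n := j)" "\<lambda>\<beta>. (\<beta> n, \<beta>(n := 0))"], goal_cases)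
    case (2 \<beta>)
    then show ?case by (auto simp: multi_indices_def sum_upd simp del: fun_upd_apply) (auto simp: le_Suc_eq)
  next
    case (3 b)
    then show ?case by (auto simp: multi_indices_def fun_eq_iff)
  next
    case (4 b)
    then show ?case by (auto simp: multi_indices_def sum_upd simp del: fun_upd_apply) auto
  qed auto
  then show ?thesis by (simp add: sum.Sigma finite_multi_indices)
qed

text \<open>The multinomial theorem summed over all degrees up to \<open>D\<close>. Splitting off
  the last coordinate gives a Cauchy product, and since the truncation is by total degree the
  triangular reindexing is exact.\<close>

lemma exponential_multinomial:
  fixes y :: "nat \<Rightarrow> real"
  shows "(\<Sum>\<beta>\<in>multi_indices n D. (\<Prod>i<n. y i ^ \<beta> i) / mfact n \<beta>) = (\<Sum>k\<le>D. (\<Sum>i<n. y i) ^ k / fact k)"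
proof (induction n arbitrary: D)
  case 0
  have "multi_indices 0 D = {\<lambda>_. 0}" by (auto simp: multi_indices_def)
  moreover have "(\<Sum>k\<le>D. (0::real) ^ k / fact k) = (\<Sum>k\<le>D. if k = 0 then 1 else 0)"
    by (intro sum.cong) auto
  ultimately show ?case by (simp add: mfact_def)
next
  case (Suc n)
  define s where "s = (\<Sum>i<n. y i)"
  have "(\<Sum>\<beta>\<in>multi_indices (Suc n) D. (\<Prod>i<Suc n. y i ^ \<beta> i) / mfact (Suc n) \<beta>) =
      (\<Sum>j\<le>D. \<Sum>\<gamma>\<in>multi_indices n (D - j). y n ^ j / fact j * ((\<Prod>i<n. y i ^ \<gamma> i) / mfact n \<gamma>))"
    by (simp add: sum_multi_indices_Suc mfact_def mult_ac)
  also have "\<dots> = (\<Sum>j\<le>D. \<Sum>k\<le>D - j. y n ^ j / fact j * (s ^ k / fact k))"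
    by (simp only: sum_distrib_left[symmetric] Suc.IH s_def)
  also have "\<dots> = (\<Sum>(j, k)\<in>(SIGMA j:{..D}. {..D - j}). y n ^ j / fact j * (s ^ k / fact k))"
    by (subst sum.Sigma) auto
  also have "(SIGMA j:{..D}. {..D - j}) = {(j, k). j + k \<le> D}" by auto
  also have "(\<Sum>(j, k)\<in>{(j, k). j + k \<le> D}. y n ^ j / fact j * (s ^ k / fact k)) =
      (\<Sum>m\<le>D. \<Sum>j\<le>m. y n ^ j / fact j * (s ^ (m - j) / fact (m - j)))"
    by (rule sum.triangle_reindex_eq)
  also have "\<dots> = (\<Sum>m\<le>D. (y n + s) ^ m / fact m)"
    unfolding binomial_ring sum_divide_distrib
    by (intro sum.cong refl) (simp add: binomial_fact field_simps)
  also have "\<dots> = (\<Sum>k\<le>D. (\<Sum>i<Suc n. y i) ^ k / fact k)"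
    by (simp add: s_def add.commute)
  finally show ?case .
qed

lemma mchoose_mfact:
  assumes "\<gamma> \<le> \<eta>"
  shows "mchoose n \<eta> \<gamma> / mfact n \<eta> = 1 / (mfact n \<gamma> * mfact n (\<lambda>i. \<eta> i - \<gamma> i))"
proof -
  have "real (mchoose n \<eta> \<gamma>) = mfact n \<eta> / (mfact n \<gamma> * mfact n (\<lambda>i. \<eta> i - \<gamma> i))"
    using assms by (simp add: mchoose_def mfact_def binomial_fact le_fun_def prod_dividef prod.distrib)
  then show ?thesis using mfact_pos[of n \<eta>] by simp
qed

lemma weighted_Cauchy_Schwarz:
  fixes w t :: "'a \<Rightarrow> real"
  assumes "\<And>i. i \<in> I \<Longrightarrow> w i \<ge> 0"
  shows "(\<Sum>i\<in>I. w i * t i)\<^sup>2 \<le> (\<Sum>i\<in>I. w i) * (\<Sum>i\<in>I. w i * (t i)\<^sup>2)"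
proof -
  have "(\<Sum>i\<in>I. w i * t i) = (\<Sum>i\<in>I. sqrt (w i) * (sqrt (w i) * t i))"
    using assms by (intro sum.cong refl) (simp flip: mult.assoc)
  moreover have "(\<Sum>i\<in>I. w i) = (\<Sum>i\<in>I. (sqrt (w i))\<^sup>2)"
    using assms by (intro sum.cong refl) simp
  moreover have "(\<Sum>i\<in>I. w i * (t i)\<^sup>2) = (\<Sum>i\<in>I. (sqrt (w i) * t i)\<^sup>2)"
    using assms by (intro sum.cong refl) (simp add: power_mult_distrib)
  ultimately show ?thesis
    using Cauchy_Schwarz_ineq_sum[of "\<lambda>i. sqrt (w i)" "\<lambda>i. sqrt (w i) * t i" I] by simp
qed

text \<open>The map (\<eta>, \<gamma>) to (\<gamma>, \<eta> - \<gamma>) is injective into pairs of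
  indices of degree at most \<open>D\<close>. Only an inequality results, as pairs of total degree
  above \<open>D\<close> are added on the right.\<close>

lemma sum_convolution_le:
  fixes F G :: "(nat \<Rightarrow> nat) \<Rightarrow> real"
  assumes F: "\<And>\<alpha>. F \<alpha> \<ge> 0" and G: "\<And>\<alpha>. G \<alpha> \<ge> 0"
  shows "(\<Sum>\<eta>\<in>multi_indices n D. \<Sum>\<gamma>\<le>\<eta>. F \<gamma> * G (\<lambda>i. \<eta> i - \<gamma> i)) \<le>
    (\<Sum>\<alpha>\<in>multi_indices n D. F \<alpha>) * (\<Sum>\<alpha>\<in>multi_indices n D. G \<alpha>)"
proof -
  let ?MI = "multi_indices n D"
  let ?S = "SIGMA \<eta>:?MI. {..\<eta>}"
  let ?h = "\<lambda>(\<eta>, \<gamma>). (\<gamma>, \<lambda>i. \<eta> i - \<gamma> i :: nat)"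
  have inj: "inj_on ?h ?S"
  proof (rule inj_onI)
    fix p p' assume p: "p \<in> ?S" "p' \<in> ?S" "?h p = ?h p'"
    obtain \<eta> \<gamma> \<eta>' \<gamma>' where eq: "p = (\<eta>, \<gamma>)" "p' = (\<eta>', \<gamma>')" by fastforce
    have *: "\<gamma> \<le> \<eta>" "\<gamma> \<le> \<eta>'" "\<gamma>' = \<gamma>" "(\<lambda>i. \<eta> i - \<gamma> i) = (\<lambda>i. \<eta>' i - \<gamma> i)"
      using p by (auto simp: eq)
    have "\<eta> i = \<eta>' i" for i
      using fun_cong[OF *(4), of i] le_funD[OF *(1), of i] le_funD[OF *(2), of i] by simp
    then have "\<eta> = \<eta>'" by (rule ext)
    then show "p = p'" by (simp add: eq *(3))
  qed
  have sub: "?h ` ?S \<subseteq> ?MI \<times> ?MI"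
  proof
    fix p assume "p \<in> ?h ` ?S"
    then obtain \<eta> \<gamma> where *: "\<eta> \<in> ?MI" "\<gamma> \<le> \<eta>" "p = (\<gamma>, \<lambda>i. \<eta> i - \<gamma> i)" by auto
    have "(\<lambda>i. \<eta> i - \<gamma> i) \<le> \<eta>" by (simp add: le_fun_def)
    then show "p \<in> ?MI \<times> ?MI" using multi_indices_downward[OF *(1)] *(2,3) by simp
  qed
  have "(\<Sum>\<eta>\<in>?MI. \<Sum>\<gamma>\<le>\<eta>. F \<gamma> * G (\<lambda>i. \<eta> i - \<gamma> i)) = (\<Sum>(\<eta>, \<gamma>)\<in>?S. F \<gamma> * G (\<lambda>i. \<eta> i - \<gamma> i))"
    using finite_lower_multi_indices[OF multi_indices_supp] finite_multi_indices
    by (subst sum.Sigma) auto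
  also have "\<dots> = (\<Sum>(\<gamma>, \<delta>)\<in>?h ` ?S. F \<gamma> * G \<delta>)"
    by (subst sum.reindex[OF inj]) (auto intro!: sum.cong)
  also have "\<dots> \<le> (\<Sum>(\<gamma>, \<delta>)\<in>?MI \<times> ?MI. F \<gamma> * G \<delta>)"
    using F G by (intro sum_mono2 sub) (auto simp: finite_multi_indices)
  also have "\<dots> = (\<Sum>\<alpha>\<in>?MI. F \<alpha>) * (\<Sum>\<alpha>\<in>?MI. G \<alpha>)"
    by (simp add: sum_product sum.cartesian_product)
  finally show ?thesis .
qed

section \<open>Cumulants against moments under the sign condition\<close>

context moment_prior
begin

lemma mixed_moment_zero: "mixed_moment n P (\<lambda>_. 0) = 1"
  by (simp add: mixed_moment_def prob_space)

lemma inc_mono: "\<alpha> \<le> \<beta> \<Longrightarrow> inc i \<alpha> \<le> inc i \<beta>"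
  by (auto simp: inc_def le_fun_def)

text \<open>Induction on the order: after removing one copy of some coordinate, the recursion writes
  the moment as a sum of products of nonnegative cumulants and moments of smaller order.\<close>

lemma mixed_moment_nonneg:
  assumes cum: "\<And>\<alpha>. \<alpha> \<in> multi_indices n D \<Longrightarrow> cumulant n P \<alpha> \<ge> 0"
    and \<alpha>: "\<alpha> \<in> multi_indices n D"
  shows "mixed_moment n P \<alpha> \<ge> 0"
  using \<alpha>
proof (induction "\<Sum>i<n. \<alpha> i" arbitrary: \<alpha> rule: less_induct)
  case less
  show ?case
  proof (cases "\<alpha> = (\<lambda>_. 0)")
    case True
    then show ?thesis by (simp add: mixed_moment_zero)
  next
    case False
    then obtain i where ai: "\<alpha> i \<noteq> 0" by auto
    then have i: "i < n" using multi_indices_supp[OF less.prems] by (meson not_less)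
    define \<eta> where "\<eta> = \<alpha>(i := \<alpha> i - 1)"
    have \<alpha>_eq: "\<alpha> = inc i \<eta>" using ai by (auto simp: inc_def \<eta>_def fun_eq_iff)
    have \<eta>_le: "\<eta> \<le> \<alpha>" by (auto simp: \<eta>_def le_fun_def)
    have "(\<Sum>k<n. \<eta> k) < (\<Sum>k<n. \<alpha> k)"
      using i ai by (intro sum_strict_mono_ex1) (auto simp: \<eta>_def)
    have "0 \<le> mchoose n \<eta> \<gamma> * cumulant n P (inc i \<gamma>) * mixed_moment n P (\<lambda>k. \<eta> k - \<gamma> k)"
      if "\<gamma> \<le> \<eta>" for \<gamma>
    proof -
      have "(\<Sum>k<n. \<eta> k - \<gamma> k) \<le> (\<Sum>k<n. \<eta> k)" by (intro sum_mono) simp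
      then have "(\<Sum>k<n. \<eta> k - \<gamma> k) < (\<Sum>k<n. \<alpha> k)" using \<open>(\<Sum>k<n. \<eta> k) < _\<close> by simp
      moreover have "(\<lambda>k. \<eta> k - \<gamma> k) \<le> \<alpha>" using \<eta>_le by (auto simp: le_fun_def intro: diff_le_self order.trans)
      ultimately have "mixed_moment n P (\<lambda>k. \<eta> k - \<gamma> k) \<ge> 0"
        using less.hyps multi_indices_downward[OF less.prems] by blast
      moreover have "cumulant n P (inc i \<gamma>) \<ge> 0"
        using cum multi_indices_downward[OF less.prems] inc_mono[OF that] \<alpha>_eq by metis
      ultimately show ?thesis by simp
    qed
    moreover have "\<forall>k\<ge>n. \<eta> k = 0"
      using multi_indices_supp[OF multi_indices_downward[OF less.prems \<eta>_le]] .
    ultimately show ?thesis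
      unfolding \<alpha>_eq using mixed_moment_eq_sum_cumulant[OF prob_space_axioms _ i, of \<eta>]
      by (auto intro!: sum_nonneg)
  qed
qed

text \<open>The cumulant is the term \<gamma> = \<eta> of the recursion, and no other term is
  negative.\<close>

lemma cumulant_le_mixed_moment:
  assumes cum: "\<And>\<alpha>. \<alpha> \<in> multi_indices n D \<Longrightarrow> cumulant n P \<alpha> \<ge> 0"
    and \<eta>: "inc i \<eta> \<in> multi_indices n D" and i: "i < n"
  shows "cumulant n P (inc i \<eta>) \<le> mixed_moment n P (inc i \<eta>)"
proof -
  have le: "\<eta> \<le> inc i \<eta>" by (simp add: inc_def le_fun_def)
  have supp: "\<forall>k\<ge>n. \<eta> k = 0" using multi_indices_supp[OF multi_indices_downward[OF \<eta> le]] .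
  let ?f = "\<lambda>\<gamma>. mchoose n \<eta> \<gamma> * cumulant n P (inc i \<gamma>) * mixed_moment n P (\<lambda>k. \<eta> k - \<gamma> k)"
  have "?f \<eta> \<le> (\<Sum>\<gamma>\<le>\<eta>. ?f \<gamma>)"
  proof (rule member_le_sum)
    fix \<gamma> assume "\<gamma> \<in> {..\<eta>} - {\<eta>}"
    then have \<gamma>: "\<gamma> \<le> \<eta>" by simp
    have "(\<lambda>k. \<eta> k - \<gamma> k) \<le> inc i \<eta>" using le by (auto simp: le_fun_def intro: diff_le_self order.trans)
    from mixed_moment_nonneg[OF cum multi_indices_downward[OF \<eta> this]]
    have "mixed_moment n P (\<lambda>k. \<eta> k - \<gamma> k) \<ge> 0" .
    moreover have "cumulant n P (inc i \<gamma>) \<ge> 0"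
      by (intro cum multi_indices_downward[OF \<eta>] inc_mono \<gamma>)
    ultimately show "0 \<le> ?f \<gamma>" by simp
  qed (use finite_lower_multi_indices[OF supp] in auto)
  then show ?thesis
    by (simp add: mixed_moment_eq_sum_cumulant[OF prob_space_axioms supp i] mixed_moment_zero mchoose_def)
qed

text \<open>The cumulant on the left may have order \<open>D + 1\<close>, where its sign is unknown.\<close>

lemma abs_cumulant_le:
  assumes cum: "\<And>\<alpha>. \<alpha> \<in> multi_indices n D \<Longrightarrow> cumulant n P \<alpha> \<ge> 0"
    and \<eta>: "\<eta> \<in> multi_indices n D" and i: "i < n"
  shows "\<bar>cumulant n P (inc i \<eta>)\<bar> \<le>
    (\<Sum>\<gamma>\<le>\<eta>. mchoose n \<eta> \<gamma> * \<bar>mixed_moment n P (inc i \<gamma>) * mixed_moment n P (\<lambda>k. \<eta> k - \<gamma> k)\<bar>)"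
proof -
  have supp: "\<forall>k\<ge>n. \<eta> k = 0" using multi_indices_supp[OF \<eta>] .
  have fin: "finite {..\<eta>}" by (rule finite_lower_multi_indices[OF supp])
  let ?f = "\<lambda>\<gamma>. mchoose n \<eta> \<gamma> * cumulant n P (inc i \<gamma>) * mixed_moment n P (\<lambda>k. \<eta> k - \<gamma> k)"
  let ?g = "\<lambda>\<gamma>. mchoose n \<eta> \<gamma> * \<bar>mixed_moment n P (inc i \<gamma>) * mixed_moment n P (\<lambda>k. \<eta> k - \<gamma> k)\<bar>"
  \<comment> \<open>For \<gamma> \<noteq> \<eta> the index \<open>inc i \<gamma>\<close> has order
    at most that of \<open>\<eta>\<close>, hence at most \<open>D\<close>, so the sign condition
    applies. Only the term \<gamma> = \<eta> can exceed this order, and it is isolated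
    below.\<close>
  have f_le: "\<bar>?f \<gamma>\<bar> \<le> ?g \<gamma>" if "\<gamma> \<in> {..\<eta>} - {\<eta>}" for \<gamma>
  proof -
    have \<gamma>: "\<gamma> \<le> \<eta>" "\<gamma> \<noteq> \<eta>" using that by auto
    have "\<exists>k. \<gamma> k < \<eta> k"
      using \<gamma> by (meson le_fun_def not_le order.antisym)
    then obtain k where k: "\<gamma> k < \<eta> k" by blast
    then have "k < n" using supp by (metis not_less not_less_zero)
    then have "(\<Sum>k<n. \<gamma> k) < (\<Sum>k<n. \<eta> k)"
      using k \<gamma>(1) by (intro sum_strict_mono_ex1) (auto simp: le_fun_def)
    moreover have "(\<Sum>k<n. inc i \<gamma> k) = (\<Sum>k<n. \<gamma> k + (if k = i then 1 else 0))"
      by (intro sum.cong) (auto simp: inc_def)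
    then have "(\<Sum>k<n. inc i \<gamma> k) = Suc (\<Sum>k<n. \<gamma> k)"
      using i by (simp add: sum.distrib)
    ultimately have inc: "inc i \<gamma> \<in> multi_indices n D"
      using \<eta> multi_indices_supp[OF multi_indices_downward[OF \<eta> \<gamma>(1)]] i
      by (auto simp: multi_indices_def) (simp add: inc_def)
    have "\<bar>cumulant n P (inc i \<gamma>)\<bar> \<le> \<bar>mixed_moment n P (inc i \<gamma>)\<bar>"
      using cum[OF inc] cumulant_le_mixed_moment[OF cum inc i] by simp
    then show ?thesis by (simp add: abs_mult mult_left_mono mult_right_mono mult.assoc)
  qed
  have "mixed_moment n P (inc i \<eta>) = cumulant n P (inc i \<eta>) + (\<Sum>\<gamma>\<in>{..\<eta>} - {\<eta>}. ?f \<gamma>)"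
    unfolding mixed_moment_eq_sum_cumulant[OF prob_space_axioms supp i]
    using fin by (subst sum.remove[of _ \<eta>]) (auto simp: mixed_moment_zero mchoose_def)
  then have "\<bar>cumulant n P (inc i \<eta>)\<bar> \<le> \<bar>mixed_moment n P (inc i \<eta>)\<bar> + \<bar>\<Sum>\<gamma>\<in>{..\<eta>} - {\<eta>}. ?f \<gamma>\<bar>"
    by linarith
  also have "\<dots> \<le> ?g \<eta> + (\<Sum>\<gamma>\<in>{..\<eta>} - {\<eta>}. ?g \<gamma>)"
  proof (rule add_mono)
    show "\<bar>mixed_moment n P (inc i \<eta>)\<bar> \<le> ?g \<eta>" by (simp add: mixed_moment_zero mchoose_def)
    have "\<bar>\<Sum>\<gamma>\<in>{..\<eta>} - {\<eta>}. ?f \<gamma>\<bar> \<le> (\<Sum>\<gamma>\<in>{..\<eta>} - {\<eta>}. \<bar>?f \<gamma>\<bar>)" by (rule sum_abs)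
    also have "\<dots> \<le> (\<Sum>\<gamma>\<in>{..\<eta>} - {\<eta>}. ?g \<gamma>)" using f_le by (rule sum_mono)
    finally show "\<bar>\<Sum>\<gamma>\<in>{..\<eta>} - {\<eta>}. ?f \<gamma>\<bar> \<le> (\<Sum>\<gamma>\<in>{..\<eta>} - {\<eta>}. ?g \<gamma>)" .
  qed
  also have "\<dots> = (\<Sum>\<gamma>\<le>\<eta>. ?g \<gamma>)" using fin by (subst (2) sum.remove[of _ \<eta>]) auto
  finally show ?thesis .
qed

text \<open>Cauchy-Schwarz with binomial weights of total mass 2^|\<eta>|, which is the origin of
  the factor 2 in \<open>2 * snr\<close>. Dividing by \<open>mfact\<close> splits the binomial into
  two factorials, so the right side is a convolution.\<close>

lemma cumulant_sq_le:
  assumes cum: "\<And>\<alpha>. \<alpha> \<in> multi_indices n D \<Longrightarrow> cumulant n P \<alpha> \<ge> 0"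
    and \<eta>: "\<eta> \<in> multi_indices n D" and i: "i < n" and snr: "snr \<ge> 0"
  shows "snr ^ mdeg n \<eta> * (cumulant n P (inc i \<eta>))\<^sup>2 / mfact n \<eta> \<le>
    (\<Sum>\<gamma>\<le>\<eta>. ((2 * snr) ^ mdeg n \<gamma> * (mixed_moment n P (inc i \<gamma>))\<^sup>2 / mfact n \<gamma>) *
       ((2 * snr) ^ mdeg n (\<lambda>k. \<eta> k - \<gamma> k) * (mixed_moment n P (\<lambda>k. \<eta> k - \<gamma> k))\<^sup>2 / mfact n (\<lambda>k. \<eta> k - \<gamma> k)))"
proof -
  have supp: "\<forall>k\<ge>n. \<eta> k = 0" using multi_indices_supp[OF \<eta>] .
  define a where "a \<gamma> = (mixed_moment n P (inc i \<gamma>))\<^sup>2" for \<gamma>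
  define b where "b \<gamma> = (mixed_moment n P \<gamma>)\<^sup>2" for \<gamma>
  have "(cumulant n P (inc i \<eta>))\<^sup>2 = \<bar>cumulant n P (inc i \<eta>)\<bar>\<^sup>2" by simp
  also have "\<dots> \<le> (\<Sum>\<gamma>\<le>\<eta>. mchoose n \<eta> \<gamma> * \<bar>mixed_moment n P (inc i \<gamma>) * mixed_moment n P (\<lambda>k. \<eta> k - \<gamma> k)\<bar>)\<^sup>2"
    by (rule power_mono[OF abs_cumulant_le[OF cum \<eta> i] abs_ge_zero])
  also have "\<dots> \<le> (\<Sum>\<gamma>\<le>\<eta>. real (mchoose n \<eta> \<gamma>)) *
      (\<Sum>\<gamma>\<le>\<eta>. mchoose n \<eta> \<gamma> * \<bar>mixed_moment n P (inc i \<gamma>) * mixed_moment n P (\<lambda>k. \<eta> k - \<gamma> k)\<bar>\<^sup>2)"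
    by (rule weighted_Cauchy_Schwarz) simp
  also have "\<dots> = 2 ^ mdeg n \<eta> * (\<Sum>\<gamma>\<le>\<eta>. mchoose n \<eta> \<gamma> * (a \<gamma> * b (\<lambda>k. \<eta> k - \<gamma> k)))"
    by (simp add: sum_mchoose[OF supp] mdeg_def a_def b_def power_mult_distrib)
  finally have "snr ^ mdeg n \<eta> * (cumulant n P (inc i \<eta>))\<^sup>2 / mfact n \<eta> \<le>
      snr ^ mdeg n \<eta> * (2 ^ mdeg n \<eta> * (\<Sum>\<gamma>\<le>\<eta>. mchoose n \<eta> \<gamma> * (a \<gamma> * b (\<lambda>k. \<eta> k - \<gamma> k)))) / mfact n \<eta>"
    using snr mfact_pos[of n \<eta>] by (intro divide_right_mono mult_left_mono) auto
  also have "\<dots> = (\<Sum>\<gamma>\<le>\<eta>. (2 * snr) ^ mdeg n \<eta> * (mchoose n \<eta> \<gamma> / mfact n \<eta>) * (a \<gamma> * b (\<lambda>k. \<eta> k - \<gamma> k)))"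
    by (simp add: sum_distrib_left sum_divide_distrib power_mult_distrib mult_ac)
  also have "\<dots> = (\<Sum>\<gamma>\<le>\<eta>. ((2 * snr) ^ mdeg n \<gamma> * a \<gamma> / mfact n \<gamma>) *
       ((2 * snr) ^ mdeg n (\<lambda>k. \<eta> k - \<gamma> k) * b (\<lambda>k. \<eta> k - \<gamma> k) / mfact n (\<lambda>k. \<eta> k - \<gamma> k)))"
  proof (rule sum.cong[OF refl])
    fix \<gamma> assume "\<gamma> \<in> {..\<eta>}"
    then have \<gamma>: "\<gamma> \<le> \<eta>" by simp
    have "mdeg n \<gamma> + mdeg n (\<lambda>k. \<eta> k - \<gamma> k) = mdeg n \<eta>"
      using \<gamma> by (simp add: mdeg_def le_fun_def flip: sum.distrib)
    then have "(2 * snr) ^ mdeg n \<eta> = (2 * snr) ^ mdeg n \<gamma> * (2 * snr) ^ mdeg n (\<lambda>k. \<eta> k - \<gamma> k)"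
      by (metis power_add)
    then show "(2 * snr) ^ mdeg n \<eta> * (mchoose n \<eta> \<gamma> / mfact n \<eta>) * (a \<gamma> * b (\<lambda>k. \<eta> k - \<gamma> k)) =
      ((2 * snr) ^ mdeg n \<gamma> * a \<gamma> / mfact n \<gamma>) *
       ((2 * snr) ^ mdeg n (\<lambda>k. \<eta> k - \<gamma> k) * b (\<lambda>k. \<eta> k - \<gamma> k) / mfact n (\<lambda>k. \<eta> k - \<gamma> k))"
      by (simp add: mchoose_mfact[OF \<gamma>])
  qed
  finally show ?thesis by (simp add: a_def b_def)
qed

section \<open>Replicas: squared moments as overlap moments\<close>

definition overlap_moment :: "nat \<Rightarrow> real" where
  "overlap_moment k = (\<integral>w. overlap n w ^ k \<partial>(P \<Otimes>\<^sub>M P))"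

lemma prob_space_pair: "prob_space (P \<Otimes>\<^sub>M P)"
proof -
  interpret pair_prob_space P P ..
  show ?thesis by unfold_locales
qed

lemma all_moments_pair_coord:
  assumes "i < n"
  shows "all_moments (P \<Otimes>\<^sub>M P) (\<lambda>w. fst w i * snd w i)"
  using all_moments_fst[OF prob_space_axioms coord[OF assms]]
    all_moments_snd[OF prob_space_axioms prob_space_axioms coord[OF assms]]
  by (rule all_moments_mult)

lemma overlap_eq: "overlap n w = (\<Sum>i<n. fst w i * snd w i)"
  by (simp add: overlap_def case_prod_beta)

lemma all_moments_overlap: "all_moments (P \<Otimes>\<^sub>M P) (overlap n)"
  unfolding overlap_eq[abs_def] by (intro all_moments_sum prob_space_pair all_moments_pair_coord) simp

lemma all_moments_pair_monomial: "all_moments (P \<Otimes>\<^sub>M P) (\<lambda>w. \<Prod>k<n. (fst w k * snd w k) ^ \<beta> k)"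
  by (intro all_moments_prod all_moments_power prob_space_pair all_moments_pair_coord) simp

lemma mixed_moment_sq:
  "(mixed_moment n P \<beta>)\<^sup>2 = (\<integral>w. (\<Prod>k<n. (fst w k * snd w k) ^ \<beta> k) \<partial>(P \<Otimes>\<^sub>M P))"
proof -
  interpret pair_prob_space P P ..
  have "(\<integral>w. (\<Prod>k<n. (fst w k * snd w k) ^ \<beta> k) \<partial>(P \<Otimes>\<^sub>M P)) =
      (\<integral>x. (\<integral>y. (\<Prod>k<n. (x k * y k) ^ \<beta> k) \<partial>P) \<partial>P)"
    using integral_fst'[OF all_moments_integrable[OF all_moments_pair_monomial[of \<beta>]]] by simp
  also have "\<dots> = (mixed_moment n P \<beta>)\<^sup>2"
    by (simp add: power_mult_distrib prod.distrib mixed_moment_def power2_eq_square)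
  finally show ?thesis ..
qed

lemma exponential_overlap:
  "(\<Sum>\<beta>\<in>multi_indices n D. c ^ mdeg n \<beta> * (\<Prod>k<n. (fst w k * snd w k) ^ \<beta> k) / mfact n \<beta>) =
    (\<Sum>k\<le>D. c ^ k * overlap n w ^ k / fact k)"
  using exponential_multinomial[of "\<lambda>k. c * (fst w k * snd w k)" n D]
  by (simp add: power_mult_distrib prod.distrib mdeg_def power_sum overlap_eq flip: sum_distrib_left)

lemma sum_mixed_moment_sq:
  "(\<Sum>\<beta>\<in>multi_indices n D. c ^ mdeg n \<beta> * (mixed_moment n P \<beta>)\<^sup>2 / mfact n \<beta>) =
    (\<Sum>k\<le>D. c ^ k * overlap_moment k / fact k)"
proof -
  have "(\<Sum>\<beta>\<in>multi_indices n D. c ^ mdeg n \<beta> * (mixed_moment n P \<beta>)\<^sup>2 / mfact n \<beta>) =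
     (\<integral>w. (\<Sum>\<beta>\<in>multi_indices n D. c ^ mdeg n \<beta> * (\<Prod>k<n. (fst w k * snd w k) ^ \<beta> k) / mfact n \<beta>) \<partial>(P \<Otimes>\<^sub>M P))"
    by (simp add: mixed_moment_sq all_moments_integrable[OF all_moments_pair_monomial])
  also have "\<dots> = (\<Sum>k\<le>D. c ^ k * overlap_moment k / fact k)"
    unfolding exponential_overlap
    by (simp add: overlap_moment_def all_moments_integrable[OF all_moments_power[OF prob_space_pair all_moments_overlap]])
  finally show ?thesis .
qed

text \<open>As in \<open>sum_mixed_moment_sq\<close>, but the extra coordinate contributes the
  factor x_i x'_i, and summing it over \<open>i\<close> gives one more overlap. Hence the power is k
  + 1 while the factorial remains that of k.\<close>

lemma sum_mixed_moment_inc_sq: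
  "(\<Sum>i<n. \<Sum>\<beta>\<in>multi_indices n D. c ^ mdeg n \<beta> * (mixed_moment n P (inc i \<beta>))\<^sup>2 / mfact n \<beta>) =
    (\<Sum>k\<le>D. c ^ k * overlap_moment (Suc k) / fact k)"
proof -
  have "(\<Sum>i<n. \<Sum>\<beta>\<in>multi_indices n D. c ^ mdeg n \<beta> * (mixed_moment n P (inc i \<beta>))\<^sup>2 / mfact n \<beta>) =
     (\<integral>w. (\<Sum>i<n. \<Sum>\<beta>\<in>multi_indices n D. c ^ mdeg n \<beta> * (\<Prod>k<n. (fst w k * snd w k) ^ inc i \<beta> k) / mfact n \<beta>) \<partial>(P \<Otimes>\<^sub>M P))"
    by (simp add: mixed_moment_sq all_moments_integrable[OF all_moments_pair_monomial])
  also have "\<dots> = (\<integral>w. (\<Sum>k\<le>D. c ^ k * overlap n w ^ Suc k / fact k) \<partial>(P \<Otimes>\<^sub>M P))"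
  proof (intro Bochner_Integration.integral_cong refl)
    fix w
    have "(\<Sum>i<n. \<Sum>\<beta>\<in>multi_indices n D. c ^ mdeg n \<beta> * (\<Prod>k<n. (fst w k * snd w k) ^ inc i \<beta> k) / mfact n \<beta>) =
       (\<Sum>i<n. (fst w i * snd w i) * (\<Sum>\<beta>\<in>multi_indices n D. c ^ mdeg n \<beta> * (\<Prod>k<n. (fst w k * snd w k) ^ \<beta> k) / mfact n \<beta>))"
      unfolding sum_distrib_left by (intro sum.cong refl) (simp only: lessThan_iff prod_power_inc, simp add: mult_ac)
    also have "\<dots> = overlap n w * (\<Sum>k\<le>D. c ^ k * overlap n w ^ k / fact k)"
      unfolding exponential_overlap by (simp add: overlap_eq sum_distrib_right)
    also have "\<dots> = (\<Sum>k\<le>D. c ^ k * overlap n w ^ Suc k / fact k)"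
      by (simp add: sum_distrib_left mult_ac)
    finally show "(\<Sum>i<n. \<Sum>\<beta>\<in>multi_indices n D. c ^ mdeg n \<beta> * (\<Prod>k<n. (fst w k * snd w k) ^ inc i \<beta> k) / mfact n \<beta>) = \<dots>" .
  qed
  also have "\<dots> = (\<Sum>k\<le>D. c ^ k * overlap_moment (Suc k) / fact k)"
    using all_moments_integrable[OF all_moments_power[OF prob_space_pair all_moments_overlap]]
    by (subst Bochner_Integration.integral_sum) (simp_all add: overlap_moment_def del: power_Suc)
  finally show ?thesis .
qed

text \<open>After the convolution bound only one factor depends on the coordinate \<open>i\<close>,
  so the sum over coordinates acts on that factor alone.\<close>

lemma low_deg_corr_sq_le_overlap:
  assumes cum: "\<And>\<alpha>. \<alpha> \<in> multi_indices n D \<Longrightarrow> cumulant n P \<alpha> \<ge> 0" and snr: "snr \<ge> 0"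
  shows "(low_deg_corr n P D snr)\<^sup>2 \<le>
    (\<Sum>k\<le>D. (2 * snr) ^ k * overlap_moment (Suc k) / fact k) *
    (\<Sum>k\<le>D. (2 * snr) ^ k * overlap_moment k / fact k)"
proof -
  define F where "F i \<gamma> = (2 * snr) ^ mdeg n \<gamma> * (mixed_moment n P (inc i \<gamma>))\<^sup>2 / mfact n \<gamma>" for i \<gamma>
  define G where "G \<gamma> = (2 * snr) ^ mdeg n \<gamma> * (mixed_moment n P \<gamma>)\<^sup>2 / mfact n \<gamma>" for \<gamma>
  have nonneg: "F i \<gamma> \<ge> 0" "G \<gamma> \<ge> 0" for i \<gamma>
    using snr mfact_pos[of n \<gamma>] by (simp_all add: F_def G_def)
  have "(low_deg_corr n P D snr)\<^sup>2 \<le>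
    (\<Sum>i<n. \<Sum>\<alpha>\<in>multi_indices n D. snr ^ mdeg n \<alpha> * (cumulant n P (inc i \<alpha>))\<^sup>2 / mfact n \<alpha>)"
    by (rule low_deg_corr_sq_le[OF snr])
  also have "\<dots> \<le> (\<Sum>i<n. \<Sum>\<eta>\<in>multi_indices n D. \<Sum>\<gamma>\<le>\<eta>. F i \<gamma> * G (\<lambda>k. \<eta> k - \<gamma> k))"
    unfolding F_def G_def by (intro sum_mono cumulant_sq_le[OF cum _ _ snr]) auto
  also have "\<dots> \<le> (\<Sum>i<n. (\<Sum>\<alpha>\<in>multi_indices n D. F i \<alpha>) * (\<Sum>\<alpha>\<in>multi_indices n D. G \<alpha>))"
    by (intro sum_mono sum_convolution_le nonneg)
  also have "\<dots> = (\<Sum>i<n. \<Sum>\<alpha>\<in>multi_indices n D. F i \<alpha>) * (\<Sum>\<alpha>\<in>multi_indices n D. G \<alpha>)"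
    by (simp add: sum_distrib_right)
  finally show ?thesis
    unfolding F_def G_def sum_mixed_moment_sq sum_mixed_moment_inc_sq .
qed

end

section \<open>Truncation at the overlap quantile\<close>

lemma sum_exp_le: "(\<Sum>k\<le>D. y ^ k / fact k) \<le> exp y" if "y \<ge> 0" for y :: real
proof -
  have "(\<Sum>k\<in>{..D}. y ^ k /\<^sub>R fact k) \<le> (\<Sum>k. y ^ k /\<^sub>R fact k)"
    using that by (intro sum_le_suminf summable_exp_generic) auto
  then show ?thesis by (simp add: exp_def divide_inverse mult.commute)
qed

context prob_space
begin

text \<open>Right continuity of the distribution function makes the infimum attained, so the
  probability bound defining the quantile holds at the quantile itself. The set is nonempty since
  \<open>a < 1\<close> and bounded below since \<open>a > 0\<close>.\<close>

lemma quantile_set_properties: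
  fixes X :: "'a \<Rightarrow> real"
  assumes X: "X \<in> borel_measurable M" and a: "a < 1" "a > 0"
  defines "S \<equiv> {y. measure M {w \<in> space M. \<bar>X w\<bar> \<le> y} \<ge> a}"
  shows "S \<noteq> {}" and "bdd_below S" and "Inf S \<in> S"
proof -
  note [measurable] = X
  define F where "F = cdf (distr M borel (\<lambda>w. \<bar>X w\<bar>))"
  interpret F: real_distribution "distr M borel (\<lambda>w. \<bar>X w\<bar>)" by (rule real_distribution_distr) simp
  have F: "F y = measure M {w \<in> space M. \<bar>X w\<bar> \<le> y}" for y
    unfolding F_def cdf_def by (subst measure_distr) (auto intro!: arg_cong[where f = "measure M"])
  have S: "S = {y. F y \<ge> a}" by (simp add: S_def F)
  have "\<forall>\<^sub>F y in at_top. F y > a"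
    using order_tendstoD(1)[OF F.cdf_lim_at_top_prob a(1)] by (simp add: F_def)
  then obtain y where "F y > a" by (auto simp: eventually_at_top_linorder)
  then show ne: "S \<noteq> {}" unfolding S by (auto intro!: exI[of _ y])
  have "y \<ge> 0" if "y \<in> S" for y
  proof (rule ccontr)
    assume "\<not> y \<ge> 0"
    then have "{w \<in> space M. \<bar>X w\<bar> \<le> y} = {}" by auto
    then have "F y = 0" by (simp only: F measure_empty)
    then show False using that a by (simp add: S)
  qed
  then show bdd: "bdd_below S" by (meson bdd_belowI)
  have "(F \<longlongrightarrow> F (Inf S)) (at_right (Inf S))"
    using F.cdf_is_right_cont by (simp add: F_def continuous_within)
  moreover have "\<forall>\<^sub>F y in at_right (Inf S). a \<le> F y"
    unfolding eventually_at_filter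
  proof (intro always_eventually allI impI)
    fix y assume "y \<noteq> Inf S" "y \<in> {Inf S<..}"
    then have "Inf S < y" by simp
    then obtain z where "z \<in> S" "z < y" using cInf_lessD[OF ne] by blast
    then show "a \<le> F y" using F.cdf_nondecreasing[of z y] by (simp add: S F_def)
  qed
  ultimately have "a \<le> F (Inf S)" by (rule tendsto_lowerbound) simp
  then show "Inf S \<in> S" by (simp add: S)
qed

end

section \<open>Tail and moments of the overlap\<close>

context moment_prior
begin

lemma overlap_quantile_mono:
  assumes "0 < d" "d \<le> d'"
  shows "overlap_quantile n P d \<le> overlap_quantile n P d'"
proof -
  interpret Q: prob_space "P \<Otimes>\<^sub>M P" by (rule prob_space_pair)
  have m: "overlap n \<in> borel_measurable (P \<Otimes>\<^sub>M P)"
    using all_moments_overlap by (simp add: all_moments_def)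
  show ?thesis unfolding overlap_quantile_def
    using assms Q.quantile_set_properties(1)[OF m, of "1 - exp (- d')"]
      Q.quantile_set_properties(2)[OF m, of "1 - exp (- d)"]
    by (intro cInf_superset_mono) (auto intro: order.trans[rotated])
qed

lemma prob_overlap_gt_quantile:
  assumes "0 < d"
  shows "measure (P \<Otimes>\<^sub>M P) {w \<in> space (P \<Otimes>\<^sub>M P). \<bar>overlap n w\<bar> > overlap_quantile n P d} \<le> exp (- d)"
proof -
  interpret Q: prob_space "P \<Otimes>\<^sub>M P" by (rule prob_space_pair)
  have m[measurable]: "overlap n \<in> borel_measurable (P \<Otimes>\<^sub>M P)"
    using all_moments_overlap by (simp add: all_moments_def)
  let ?A = "{w \<in> space (P \<Otimes>\<^sub>M P). \<bar>overlap n w\<bar> \<le> overlap_quantile n P d}"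
  have "measure (P \<Otimes>\<^sub>M P) ?A \<ge> 1 - exp (- d)"
    using Q.quantile_set_properties(3)[OF m, of "1 - exp (- d)"] assms
    unfolding overlap_quantile_def by simp
  moreover have "{w \<in> space (P \<Otimes>\<^sub>M P). \<bar>overlap n w\<bar> > overlap_quantile n P d} = space (P \<Otimes>\<^sub>M P) - ?A"
    by auto
  ultimately show ?thesis by (simp add: Q.prob_compl)
qed

text \<open>Off the tail event the power is at most T^k. On it, the weight \<open>\<tau>\<close> =
  exp (- S / 2) balances the two costs: the tail probability divided by \<open>\<tau>\<close> is at
  most \<open>\<tau>\<close>, and the moment of order 2k is also multiplied by
  \<open>\<tau>\<close>.\<close>

lemma overlap_moment_le_truncated:
  assumes T: "T > 0" and S: "measure (P \<Otimes>\<^sub>M P) {w \<in> space (P \<Otimes>\<^sub>M P). \<bar>overlap n w\<bar> > T} \<le> exp (- S)"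
  shows "overlap_moment k \<le> T ^ k + exp (- S / 2) / 2 * (overlap_moment (2 * k) + 1)"
proof -
  interpret Q: prob_space "P \<Otimes>\<^sub>M P" by (rule prob_space_pair)
  have [measurable]: "overlap n \<in> borel_measurable (P \<Otimes>\<^sub>M P)"
    using all_moments_overlap by (simp add: all_moments_def)
  define A where "A = {w \<in> space (P \<Otimes>\<^sub>M P). \<bar>overlap n w\<bar> > T}"
  have [measurable]: "A \<in> sets (P \<Otimes>\<^sub>M P)" unfolding A_def by measurable
  define \<tau> where "\<tau> = exp (- S / 2)"
  have \<tau>: "\<tau> > 0" "\<tau> * \<tau> = exp (- S)" by (simp_all add: \<tau>_def flip: exp_add)
  have int: "integrable (P \<Otimes>\<^sub>M P) (\<lambda>w. overlap n w ^ j)" for j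
    by (rule all_moments_integrable[OF all_moments_power[OF prob_space_pair all_moments_overlap]])
  have intA: "integrable (P \<Otimes>\<^sub>M P) (indicator A :: _ \<Rightarrow> real)"
    by (rule integrable_real_indicator) (simp_all add: Q.emeasure_finite less_top[symmetric])
  \<comment> \<open>AM-GM: \<open>2 y \<le> \<tau> y^2 + 1/\<tau>\<close> on the tail event\<close>
  have pt: "overlap n w ^ k \<le> T ^ k + (\<tau> * overlap n w ^ (2 * k) + indicator A w / \<tau>) / 2"
    if w: "w \<in> space (P \<Otimes>\<^sub>M P)" for w
  proof (cases "w \<in> A")
    case True
    define y where "y = overlap n w ^ k"
    have "0 \<le> (\<tau> * y - 1)\<^sup>2 / \<tau>" using \<tau> by simp
    also have "(\<tau> * y - 1)\<^sup>2 / \<tau> = \<tau> * y\<^sup>2 - 2 * y + 1 / \<tau>"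
      using \<tau>(1) by (simp add: power2_eq_square field_simps)
    finally have "y \<le> (\<tau> * y\<^sup>2 + 1 / \<tau>) / 2" by simp
    moreover have "y\<^sup>2 = overlap n w ^ (2 * k)" by (simp add: y_def power_mult mult.commute power_even_eq)
    moreover have "T ^ k > 0" using T by simp
    moreover have "indicator A w = (1 :: real)" using True by simp
    ultimately show ?thesis
      unfolding y_def by (simp only:)
  next
    case False
    then have "\<bar>overlap n w\<bar> ^ k \<le> T ^ k" using w by (intro power_mono) (auto simp: A_def)
    then have "overlap n w ^ k \<le> T ^ k" by (simp add: abs_le_iff power_abs[symmetric])
    moreover have "0 \<le> \<tau> * overlap n w ^ (2 * k)" using \<tau>(1) by (simp add: power_mult)
    ultimately show ?thesis using False by simp
  qed
  have "overlap_moment k \<le> (\<integral>w. T ^ k + (\<tau> * overlap n w ^ (2 * k) + indicator A w / \<tau>) / 2 \<partial>(P \<Otimes>\<^sub>M P))"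
    unfolding overlap_moment_def
    by (intro integral_mono pt Bochner_Integration.integrable_add integrable_const
        integrable_divide_zero integrable_mult_right int intA impI) auto
  also have "\<dots> = T ^ k + (\<tau> * overlap_moment (2 * k) + measure (P \<Otimes>\<^sub>M P) A / \<tau>) / 2"
    using int[of "2 * k"] intA by (simp add: overlap_moment_def Q.prob_space)
  also have "\<dots> \<le> T ^ k + (\<tau> * overlap_moment (2 * k) + \<tau>) / 2"
  proof -
    have "measure (P \<Otimes>\<^sub>M P) A / \<tau> \<le> \<tau>"
      using S \<tau> by (simp add: A_def divide_le_eq)
    then show ?thesis by (intro add_left_mono divide_right_mono) auto
  qed
  finally show ?thesis by (simp add: \<tau>_def algebra_simps)
qed

text \<open>The sum of \<open>n\<close> terms is at most \<open>n\<close> times the largest, whose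
  power is at most the sum of powers; independence of the replicas gives B^2 per coordinate. The
  bound is crude, but it is only used multiplied by the small tail factor.\<close>

lemma overlap_moment_le_marginals:
  assumes n: "n > 0" and B: "\<And>i. i < n \<Longrightarrow> (\<integral>x. \<bar>x i\<bar> ^ m \<partial>P) \<le> B"
  shows "overlap_moment m \<le> real n ^ Suc m * B\<^sup>2"
proof -
  interpret pair_prob_space P P ..
  have abs_coord: "all_moments (P \<Otimes>\<^sub>M P) (\<lambda>w. \<bar>fst w i * snd w i\<bar>)" if "i < n" for i
    using all_moments_pair_coord[OF that] by (auto simp: all_moments_def)
  have intm: "integrable (P \<Otimes>\<^sub>M P) (\<lambda>w. \<bar>fst w i * snd w i\<bar> ^ m)" if "i < n" for i
    by (rule all_moments_integrable[OF all_moments_power[OF prob_space_pair abs_coord[OF that]]])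
  have pt: "overlap n w ^ m \<le> real n ^ m * (\<Sum>i<n. \<bar>fst w i * snd w i\<bar> ^ m)" for w
  proof -
    define a where "a i = \<bar>fst w i * snd w i\<bar>" for i
    define b where "b = Max (a ` {..<n})"
    have b: "a i \<le> b" if "i < n" for i using that by (simp add: b_def)
    have "b \<in> a ` {..<n}" unfolding b_def using n by (intro Max_in) auto
    then obtain j where j: "j < n" "b = a j" by auto
    have "\<bar>overlap n w\<bar> \<le> (\<Sum>i<n. a i)" unfolding overlap_eq a_def by (rule sum_abs)
    also have "\<dots> \<le> real n * b" using sum_bounded_above[of "{..<n}" a b] b by simp
    finally have "\<bar>overlap n w\<bar> ^ m \<le> (real n * b) ^ m" by (intro power_mono) auto
    also have "\<dots> = real n ^ m * a j ^ m" by (simp add: power_mult_distrib j)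
    also have "\<dots> \<le> real n ^ m * (\<Sum>i<n. a i ^ m)"
      using j by (intro mult_left_mono member_le_sum) (auto simp: a_def)
    finally show ?thesis by (simp add: a_def abs_le_iff power_abs[symmetric])
  qed
  have one: "(\<integral>w. \<bar>fst w i * snd w i\<bar> ^ m \<partial>(P \<Otimes>\<^sub>M P)) \<le> B\<^sup>2" if i: "i < n" for i
  proof -
    have "(\<integral>w. \<bar>fst w i * snd w i\<bar> ^ m \<partial>(P \<Otimes>\<^sub>M P)) = (\<integral>x. (\<integral>y. \<bar>x i * y i\<bar> ^ m \<partial>P) \<partial>P)"
      using integral_fst'[OF intm[OF i]] by simp
    also have "\<dots> = (\<integral>x. \<bar>x i\<bar> ^ m \<partial>P) * (\<integral>x. \<bar>x i\<bar> ^ m \<partial>P)"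
      by (simp add: abs_mult power_mult_distrib)
    also have "\<dots> \<le> B * B" using B[OF i]
      by (intro mult_mono) (auto intro: order.trans[rotated] Bochner_Integration.integral_nonneg)
    finally show ?thesis by (simp add: power2_eq_square)
  qed
  have "overlap_moment m \<le> (\<integral>w. real n ^ m * (\<Sum>i<n. \<bar>fst w i * snd w i\<bar> ^ m) \<partial>(P \<Otimes>\<^sub>M P))"
    unfolding overlap_moment_def
    by (intro integral_mono pt integrable_mult_right Bochner_Integration.integrable_sum impI intm
        all_moments_integrable[OF all_moments_power[OF prob_space_pair all_moments_overlap]]) simp
  also have "\<dots> = real n ^ m * (\<Sum>i<n. \<integral>w. \<bar>fst w i * snd w i\<bar> ^ m \<partial>(P \<Otimes>\<^sub>M P))"
    using intm by (simp add: Bochner_Integration.integral_sum)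
  also have "\<dots> \<le> real n ^ m * (\<Sum>i<n. B\<^sup>2)"
    by (intro mult_left_mono sum_mono one) auto
  finally show ?thesis by (simp add: mult_ac)
qed

text \<open>Each truncated series is at most \<open>\<delta>\<close> times exp (2 snr T), the
  shifted one with an additional factor \<open>T\<close>. The shift is why moments up to order
  \<open>Suc D\<close> are controlled.\<close>

lemma low_deg_corr_sq_le_exp:
  assumes cum: "\<And>\<alpha>. \<alpha> \<in> multi_indices n D \<Longrightarrow> cumulant n P \<alpha> \<ge> 0" and snr: "snr \<ge> 0"
    and T: "T > 0" and \<delta>: "\<delta> \<ge> 0"
    and M: "\<And>k. k \<le> Suc D \<Longrightarrow> overlap_moment k \<le> \<delta> * T ^ k"
  shows "(low_deg_corr n P D snr)\<^sup>2 \<le> \<delta>\<^sup>2 * T * exp (4 * snr * T)"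
proof -
  let ?c = "2 * snr"
  have e: "(\<Sum>k\<le>D. (?c * T) ^ k / fact k) \<le> exp (?c * T)"
    using snr T by (intro sum_exp_le) simp
  have A: "(\<Sum>k\<le>D. ?c ^ k * overlap_moment (Suc k) / fact k) \<le> \<delta> * T * exp (?c * T)"
  proof -
    have "(\<Sum>k\<le>D. ?c ^ k * overlap_moment (Suc k) / fact k) \<le> (\<Sum>k\<le>D. ?c ^ k * (\<delta> * T ^ Suc k) / fact k)"
      using snr by (intro sum_mono divide_right_mono mult_left_mono M) auto
    also have "\<dots> = \<delta> * T * (\<Sum>k\<le>D. (?c * T) ^ k / fact k)"
      by (simp add: sum_distrib_left power_mult_distrib mult_ac)
    also have "\<dots> \<le> \<delta> * T * exp (?c * T)" using \<delta> T e by (intro mult_left_mono) auto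
    finally show ?thesis .
  qed
  have B: "(\<Sum>k\<le>D. ?c ^ k * overlap_moment k / fact k) \<le> \<delta> * exp (?c * T)"
  proof -
    have "(\<Sum>k\<le>D. ?c ^ k * overlap_moment k / fact k) \<le> (\<Sum>k\<le>D. ?c ^ k * (\<delta> * T ^ k) / fact k)"
      using snr M by (intro sum_mono divide_right_mono mult_left_mono) auto
    also have "\<dots> = \<delta> * (\<Sum>k\<le>D. (?c * T) ^ k / fact k)"
      by (simp add: sum_distrib_left power_mult_distrib mult_ac)
    also have "\<dots> \<le> \<delta> * exp (?c * T)" using \<delta> e by (intro mult_left_mono) auto
    finally show ?thesis .
  qed
  \<comment> \<open>Multiplying the two bounds requires the second factor to be nonnegative; this is
    seen by writing it back as a weighted sum of squared moments.\<close>
  have B0: "0 \<le> (\<Sum>k\<le>D. ?c ^ k * overlap_moment k / fact k)"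
    unfolding sum_mixed_moment_sq[symmetric] using snr mfact_pos[of n]
    by (intro sum_nonneg divide_nonneg_nonneg mult_nonneg_nonneg) (auto intro: less_imp_le)
  have "(low_deg_corr n P D snr)\<^sup>2 \<le> (\<Sum>k\<le>D. ?c ^ k * overlap_moment (Suc k) / fact k) *
    (\<Sum>k\<le>D. ?c ^ k * overlap_moment k / fact k)"
    by (rule low_deg_corr_sq_le_overlap[OF cum snr])
  also have "\<dots> \<le> (\<delta> * T * exp (?c * T)) * (\<delta> * exp (?c * T))"
    using A B B0 \<delta> T by (intro mult_mono) auto
  also have "\<dots> = \<delta>\<^sup>2 * T * (exp (?c * T) * exp (?c * T))" by (simp add: power2_eq_square)
  also have "exp (?c * T) * exp (?c * T) = exp (4 * snr * T)" by (simp flip: exp_add)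
  finally show ?thesis .
qed

text \<open>The bound at a fixed dimension: the hypotheses \<open>large\<close> list the thresholds
  in \<open>n\<close>, which involve only constants independent of the dimension.\<close>

lemma low_deg_corr_sq_le_quantile:
  fixes C \<phi> L C\<^sub>1 T snr :: real and D :: nat
  assumes cum: "\<And>\<alpha>. \<alpha> \<in> multi_indices n D \<Longrightarrow> cumulant n P \<alpha> \<ge> 0"
    and D: "D > 0" "real D \<le> real n powr C" and pos: "\<phi> > 0" "L > 0" "C\<^sub>1 > 0" "C > 0"
    and marginal: "\<And>i m. i < n \<Longrightarrow> m \<ge> 1 \<Longrightarrow> (\<integral>x. \<bar>x i\<bar> ^ m \<partial>P) \<le> (L * real m powr (1 / \<phi>)) ^ m"
    and T: "T \<ge> real n powr (- C\<^sub>1)"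
    and tail: "measure (P \<Otimes>\<^sub>M P) {w \<in> space (P \<Otimes>\<^sub>M P). \<bar>overlap n w\<bar> > T} \<le> exp (- (real D * (ln (real n))\<^sup>2))"
    and snr: "snr \<ge> 0" "snr \<le> 1 / (T * ln (real n))"
    and large: "n \<ge> 100" "ln (real n) \<ge> 40" "real n \<ge> max 1 L * 4 powr (1 / \<phi>)"
      "ln (real n) \<ge> 2 * (5 + 8 * (1 + C / \<phi>) + 2 * C\<^sub>1) + 2"
  shows "(low_deg_corr n P D snr)\<^sup>2 \<le> 2 * T"
proof -
  define l where "l = ln (real n)"
  \<comment> \<open>Bounds the sub-Weibull factor of every moment order up to 4D. The
    \<open>max 1 L\<close> makes \<open>W \<ge> 1\<close>, so exponents may be enlarged.\<close>
  define W where "W = max 1 L * real (4 * D) powr (1 / \<phi>)"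
  define c where "c = 5 + 8 * (1 + C / \<phi>)"
  have n: "real n > 0" "real n \<ge> 1" using large(1) by simp_all
  have l: "l \<ge> 40" "l > 0" using large(2) by (simp_all add: l_def)
  have T0: "T > 0" using T n by (intro less_le_trans[OF _ T]) simp
  have D1: "real D \<ge> 1" using D(1) by simp
  have W1: "W \<ge> 1"
  proof -
    have "1 \<le> real (4 * D) powr (1 / \<phi>)" using D(1) pos by (intro ge_one_powr_ge_zero) auto
    then have "1 * 1 \<le> W" unfolding W_def by (intro mult_mono) auto
    then show ?thesis by simp
  qed
  have W_le: "W \<le> exp ((1 + C / \<phi>) * l)"
  proof -
    have "real (4 * D) powr (1 / \<phi>) \<le> (4 * real n powr C) powr (1 / \<phi>)"
      using D pos by (intro powr_mono2) auto
    also have "\<dots> = 4 powr (1 / \<phi>) * real n powr (C / \<phi>)"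
      using n by (simp add: powr_mult powr_powr)
    finally have "W \<le> max 1 L * (4 powr (1 / \<phi>) * real n powr (C / \<phi>))"
      unfolding W_def by (intro mult_left_mono) auto
    also have "\<dots> = (max 1 L * 4 powr (1 / \<phi>)) * real n powr (C / \<phi>)" by simp
    also have "\<dots> \<le> real n * real n powr (C / \<phi>)"
      using large(3) by (intro mult_right_mono) auto
    also have "\<dots> = exp ((1 + C / \<phi>) * l)"
      using n by (simp add: powr_def l_def distrib_right exp_add)
    finally show ?thesis .
  qed
  have even_moment: "overlap_moment (2 * k) \<le> exp (c * real D * l)" if k: "1 \<le> k" "k \<le> Suc D" for k
  proof -
    \<comment> \<open>Since D \<ge> 1, 2k \<le> 2D + 2 \<le> 4D and 2k + 1 \<le> 5D. The resulting
      bound n^(5D) W^(8D) is where the constant \<open>c\<close> comes from.\<close>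
    have k4: "2 * k \<le> 4 * D" using k D by simp
    have "(\<integral>x. \<bar>x i\<bar> ^ (2 * k) \<partial>P) \<le> W ^ (4 * D)" if i: "i < n" for i
    proof -
      have "(\<integral>x. \<bar>x i\<bar> ^ (2 * k) \<partial>P) \<le> (L * real (2 * k) powr (1 / \<phi>)) ^ (2 * k)"
        using i k by (intro marginal) auto
      also have "\<dots> \<le> W ^ (2 * k)"
      proof -
        have "real (2 * k) powr (1 / \<phi>) \<le> real (4 * D) powr (1 / \<phi>)"
          using k4 pos by (intro powr_mono2) auto
        then have "L * real (2 * k) powr (1 / \<phi>) \<le> W"
          unfolding W_def using pos by (intro mult_mono) auto
        then show ?thesis using pos by (intro power_mono) auto
      qed
      also have "\<dots> \<le> W ^ (4 * D)" using k4 W1 by (intro power_increasing) auto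
      finally show ?thesis .
    qed
    then have "overlap_moment (2 * k) \<le> real n ^ Suc (2 * k) * (W ^ (4 * D))\<^sup>2"
      using n by (intro overlap_moment_le_marginals) auto
    also have "\<dots> \<le> real n ^ (5 * D) * W ^ (8 * D)"
    proof -
      have "real n ^ Suc (2 * k) \<le> real n ^ (5 * D)"
        using k4 D n by (intro power_increasing) auto
      moreover have "(W ^ (4 * D))\<^sup>2 = W ^ (8 * D)" by (simp flip: power_mult)
      ultimately show ?thesis using W1 by (auto intro!: mult_right_mono)
    qed
    also have "\<dots> \<le> exp l ^ (5 * D) * exp ((1 + C / \<phi>) * l) ^ (8 * D)"
      using n W_le W1 by (intro mult_mono power_mono) (auto simp: l_def)
    also have "\<dots> = exp (c * real D * l)"
      by (simp add: c_def algebra_simps flip: exp_of_nat_mult exp_add)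
    finally show ?thesis .
  qed
  have M: "overlap_moment k \<le> 1.01 * T ^ k" if k: "k \<le> Suc D" for k
  proof (cases "k = 0")
    case True
    then show ?thesis by (simp add: overlap_moment_def prob_space.prob_space[OF prob_space_pair])
  next
    case False
    have E1: "exp (c * real D * l) \<ge> 1" using pos l by (simp add: c_def)
    have "overlap_moment k \<le> T ^ k + exp (- (real D * l\<^sup>2) / 2) / 2 * (overlap_moment (2 * k) + 1)"
      using tail by (intro overlap_moment_le_truncated[OF T0]) (simp add: l_def)
    also have "\<dots> \<le> T ^ k + exp (- (real D * l\<^sup>2) / 2) / 2 * (exp (c * real D * l) + exp (c * real D * l))"
      using even_moment[of k] E1 False k by (intro add_left_mono mult_left_mono add_mono) auto
    also have "\<dots> = T ^ k + exp (- (real D * l\<^sup>2) / 2 + c * real D * l)"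
      by (simp only: exp_add) simp
    also have "exp (- (real D * l\<^sup>2) / 2 + c * real D * l) \<le> 0.01 * T ^ k"
    proof -
      \<comment> \<open>The exponent is split so that one factor is at most exp (- l) = 1 / n by the
        last threshold, and the other is at most T^k because T \<ge> n^(-C1) and k \<le> D + 1 \<le>
        2D.\<close>
      have "exp (- (real D * l\<^sup>2) / 2 + c * real D * l) =
          exp (real D * l * (c + 2 * C\<^sub>1 - l / 2)) * exp (- (2 * C\<^sub>1 * real D * l))"
        by (simp add: power2_eq_square algebra_simps flip: exp_add)
      also have "exp (real D * l * (c + 2 * C\<^sub>1 - l / 2)) \<le> 0.01"
      proof -
        have "c + 2 * C\<^sub>1 - l / 2 \<le> - 1" using large(4) by (simp add: c_def l_def)
        then have "real D * l * (c + 2 * C\<^sub>1 - l / 2) \<le> real D * l * (- 1)"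
          using l by (intro mult_left_mono) auto
        also have "\<dots> \<le> - l" using D1 l by simp
        finally have "exp (real D * l * (c + 2 * C\<^sub>1 - l / 2)) \<le> exp (- l)" by simp
        also have "\<dots> = 1 / real n" using n by (simp add: l_def exp_minus inverse_eq_divide)
        also have "\<dots> \<le> 0.01" using large(1) by (simp add: field_simps)
        finally show ?thesis .
      qed
      also have "exp (- (2 * C\<^sub>1 * real D * l)) \<le> T ^ k"
      proof -
        have "exp (- (2 * C\<^sub>1 * real D * l)) \<le> exp (- (C\<^sub>1 * real k * l))"
        proof -
          have "real k \<le> 2 * real D" using k D by linarith
          then have "C\<^sub>1 * l * real k \<le> C\<^sub>1 * l * (2 * real D)"
            using pos l by (intro mult_left_mono) auto
          then show ?thesis by (simp add: mult_ac)
        qed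
        also have "\<dots> = (real n powr (- C\<^sub>1)) ^ k"
          using n by (simp add: powr_def l_def mult_ac flip: exp_of_nat_mult)
        also have "\<dots> \<le> T ^ k" using T by (intro power_mono) auto
        finally show ?thesis .
      qed
      finally show ?thesis by simp
    qed
    finally show ?thesis by simp
  qed
  have "(low_deg_corr n P D snr)\<^sup>2 \<le> 1.01\<^sup>2 * T * exp (4 * snr * T)"
    by (rule low_deg_corr_sq_le_exp[OF cum snr(1) T0 _ M]) simp_all
  \<comment> \<open>From snr T \<le> 1 / l \<le> 1 / 40 the exponent 4 snr T is at most 0.1. Then
    exp 0.1 \<le> 1.11, and 1.01^2 times 1.11 is well below 2.\<close>
  also have "\<dots> \<le> 1.01\<^sup>2 * T * exp 0.1"
  proof -
    have "snr * T \<le> 1 / l"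
      using snr(2) T0 l by (simp add: l_def field_simps)
    also have "\<dots> \<le> 1 / 40" using l by (simp add: field_simps)
    finally show ?thesis using T0 by (intro mult_left_mono) auto
  qed
  also have "\<dots> \<le> 1.01\<^sup>2 * T * (1 + 0.1 + 0.1\<^sup>2)"
    using T0 by (intro mult_left_mono exp_bound) auto
  also have "\<dots> \<le> 2 * T" using T0 by (simp add: power2_eq_square)
  finally show ?thesis .
qed

end

section \<open>The Franz--Parisi criterion\<close>

lemma moment_prior_sub_weibull:
  assumes prior: "is_prior n P" and sw: "\<And>i. i < n \<Longrightarrow> sub_weibull \<phi> K C P (\<lambda>x. x i)"
  shows "moment_prior P n"
proof -
  interpret prob_space P using prior by (simp add: is_prior_def)
  have sets: "sets P = sets (Pi\<^sub>M {..<n} (\<lambda>_. borel))" using prior by (simp add: is_prior_def)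
  show ?thesis
  proof
    fix i assume i: "i < n"
    have "(\<lambda>x. x i) \<in> borel_measurable (Pi\<^sub>M {..<n} (\<lambda>_. borel :: real measure))"
      using i by (intro measurable_component_singleton) simp
    then have "(\<lambda>x. x i) \<in> borel_measurable P"
      using measurable_cong_sets[OF sets refl] by blast
    moreover have "integrable P (\<lambda>x. \<bar>x i\<bar> ^ k)" for k :: nat
    proof (cases k)
      case (Suc j)
      then have "integrable P (\<lambda>x. \<bar>x i\<bar> powr real k)"
        using sw[OF i] by (simp add: sub_weibull_def)
      then show ?thesis using Suc by (simp add: powr_realpow' del: of_nat_Suc)
    qed simp
    ultimately show "all_moments P (\<lambda>x. x i)" by (simp add: all_moments_def)
  qed
qed

lemma sub_weibull_moment_le:
  assumes sw: "sub_weibull \<phi> K C M X" and m: "m \<ge> 1"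
  shows "(\<integral>\<omega>. \<bar>X \<omega>\<bar> ^ m \<partial>M) \<le> (C * K * real m powr (1 / \<phi>)) ^ m"
proof -
  define I where "I = (\<integral>\<omega>. \<bar>X \<omega>\<bar> ^ m \<partial>M)"
  have I: "I = (\<integral>\<omega>. \<bar>X \<omega>\<bar> powr real m \<partial>M)"
    unfolding I_def using m by (simp add: powr_realpow')
  have "I \<ge> 0" by (simp add: I_def)
  have "I powr (1 / real m) \<le> C * K * real m powr (1 / \<phi>)"
    unfolding I using sw m by (simp add: sub_weibull_def)
  then have "(I powr (1 / real m)) ^ m \<le> (C * K * real m powr (1 / \<phi>)) ^ m"
    by (intro power_mono) auto
  moreover have "(I powr (1 / real m)) ^ m = I"
    using \<open>I \<ge> 0\<close> m by (simp add: powr_powr flip: powr_realpow')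
  ultimately show ?thesis by (simp add: I_def)
qed

text \<open>The ratio enters the potential linearly, so \<open>u\<close> plus its slope is minus the
  logarithmic derivative of the density, whatever \<open>u\<close> is. Positivity of
  \<open>p q\<close> makes the logarithm differentiable.\<close>

lemma deriv_fp_ann:
  assumes "p differentiable (at q)" "p q > 0"
  shows "deriv (fp_ann p u) q = - u - deriv (\<lambda>t. ln (p t)) q"
proof -
  obtain p' where p': "(p has_real_derivative p') (at q)"
    using assms(1) by (auto simp: real_differentiable_def)
  have ln: "((\<lambda>t. ln (p t)) has_real_derivative p' / p q) (at q)"
    using p' assms(2) by (auto intro!: derivative_eq_intros)
  have "(fp_ann p u has_real_derivative - u - p' / p q) (at q)"
    unfolding fp_ann_def[abs_def]
    by (rule DERIV_diff[OF _ ln]) (auto intro!: derivative_eq_intros)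
  then show ?thesis using ln by (simp add: DERIV_imp_deriv)
qed

theorem theorem2p7:
  fixes C :: real and D D' :: "nat \<Rightarrow> nat" and A :: "nat \<Rightarrow> real"
    and P :: "nat \<Rightarrow> (nat \<Rightarrow> real) measure"
    and p :: "nat \<Rightarrow> real \<Rightarrow> real"
    and \<phi> K C\<^sub>\<phi> C\<^sub>1 :: real
    and \<epsilon> :: "nat \<Rightarrow> real"
    and q :: "nat \<Rightarrow> real \<Rightarrow> real"
  defines "q \<equiv> (\<lambda>n. overlap_quantile n (P n))"
  assumes C_pos: "C > 0"
    and D_pos: "\<And>n. D n > 0"
    and D_le: "\<And>n. n \<ge> 2 \<Longrightarrow> real (D n) \<le> real n powr C"
    and A_pos: "\<And>n. A n > 0"
    and prior: "\<And>n. n \<ge> 2 \<Longrightarrow> is_prior n (P n)"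
    and density_nonneg: "\<And>n t. n \<ge> 2 \<Longrightarrow> p n t \<ge> 0"
    and density: "\<And>n. n \<ge> 2 \<Longrightarrow>
          distributed (P n \<Otimes>\<^sub>M P n) lborel (overlap n) (\<lambda>t. ennreal (p n t))"
    and density_diff: "\<And>n t. n \<ge> 2 \<Longrightarrow> p n differentiable (at t)"
    and cumulants: "\<And>n \<alpha>. n \<ge> 2 \<Longrightarrow> \<alpha> \<in> multi_indices n (D n) \<Longrightarrow> cumulant n (P n) \<alpha> \<ge> 0"
    and weibull_consts: "\<phi> > 0" "K > 0" "C\<^sub>\<phi> > 0"
    and weibull: "\<And>n i. n \<ge> 2 \<Longrightarrow> i < n \<Longrightarrow> sub_weibull \<phi> K C\<^sub>\<phi> (P n) (\<lambda>x. x i)"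
    and C\<^sub>1_pos: "C\<^sub>1 > 0"
    and quantile: "\<And>n. n \<ge> 2 \<Longrightarrow>
          q n (real (D n) * (ln (real n))\<^sup>2)
            \<ge> max (ln (real n) powr (- real (D n) / 2)) (real n powr (- C\<^sub>1))"
    and density_pos: "\<And>n. n \<ge> 2 \<Longrightarrow> p n (q n (real (D n))) > 0"
    and log_density_deriv: "\<And>n. n \<ge> 2 \<Longrightarrow>
          deriv (\<lambda>t. ln (p n t)) (q n (real (D n)))
            \<ge> - (A n / (q n (real (D n) * (ln (real n))\<^sup>2) * ln (real n)))"
    and D'_pos: "\<And>n. D' n > 0"
    and D'_eq: "\<And>n. n \<ge> 2 \<Longrightarrow> real (D' n) = (1 + \<epsilon> n) * (real (D n) * (ln (real n))\<^sup>2)"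
    and \<epsilon>_lim: "\<epsilon> \<longlonglongrightarrow> 0"
    and \<epsilon>_nonneg: "\<forall>\<^sub>F n in sequentially. \<epsilon> n \<ge> 0"
  shows "(\<forall>\<^sub>F n in sequentially. \<forall>u>0.
            u + deriv (fp_ann (p n) u) (q n (real (D n))) > 0 \<longrightarrow>
            (low_deg_corr n (P n) (D n)
               (1 / A n * (u + deriv (fp_ann (p n) u) (q n (real (D n))))))\<^sup>2
              \<le> 2 * q n (real (D' n)))
       \<and> (\<forall>snr. (\<forall>n. snr n > 0) \<longrightarrow> (\<forall>\<^sub>F n in sequentially.
            deriv (fp_ann (p n) (snr n)) (q n (real (D n))) \<ge> 0 \<longrightarrow>
            (low_deg_corr n (P n) (D n) (1 / A n * snr n))\<^sup>2 \<le> 2 * q n (real (D' n))))"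
proof -
  define T where "T n = q n (real (D n) * (ln (real n))\<^sup>2)" for n
  define L where "L = C\<^sub>\<phi> * K"
  have L: "L > 0" using weibull_consts by (simp add: L_def)
  have "\<forall>\<^sub>F n in sequentially. ln (real n) \<ge> x" for x
    using filterlim_compose[OF ln_at_top filterlim_real_sequentially] by (simp add: filterlim_at_top)
  moreover have "\<forall>\<^sub>F n in sequentially. real n \<ge> x" for x
    using filterlim_real_sequentially by (simp add: filterlim_at_top)
  ultimately have large: "\<forall>\<^sub>F n in sequentially. \<epsilon> n \<ge> 0 \<and> n \<ge> 100 \<and> ln (real n) \<ge> 40 \<and>
      real n \<ge> max 1 L * 4 powr (1 / \<phi>) \<and>
      ln (real n) \<ge> 2 * (5 + 8 * (1 + C / \<phi>) + 2 * C\<^sub>1) + 2"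
    by (intro eventually_conj \<epsilon>_nonneg eventually_ge_at_top)
  \<comment> \<open>Both conclusions concern ratios with \<open>A n * snr\<close> at most minus the
    logarithmic derivative: the first with equality, the second with inequality. The ratio is
    quantified after the dimension, so the threshold in \<open>n\<close> is uniform in
    \<open>u\<close>.\<close>
  have main: "\<forall>\<^sub>F n in sequentially. \<forall>snr. 0 \<le> snr \<longrightarrow>
      A n * snr \<le> - deriv (\<lambda>t. ln (p n t)) (q n (real (D n))) \<longrightarrow>
      (low_deg_corr n (P n) (D n) snr)\<^sup>2 \<le> 2 * q n (real (D' n))"
    using large
  proof (rule eventually_mono, intro allI impI)
    fix n snr
    assume n: "\<epsilon> n \<ge> 0 \<and> n \<ge> 100 \<and> ln (real n) \<ge> 40 \<and> real n \<ge> max 1 L * 4 powr (1 / \<phi>) \<and>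
      ln (real n) \<ge> 2 * (5 + 8 * (1 + C / \<phi>) + 2 * C\<^sub>1) + 2"
      and snr: "0 \<le> snr" "A n * snr \<le> - deriv (\<lambda>t. ln (p n t)) (q n (real (D n)))"
    have n2: "n \<ge> 2" using n by linarith
    interpret moment_prior "P n" n
      using moment_prior_sub_weibull[OF prior[OF n2] weibull[OF n2]] .
    have d: "0 < real (D n) * (ln (real n))\<^sup>2" using D_pos[of n] n by auto
    \<comment> \<open>Combining the lower bound on the logarithmic derivative with the condition on
      \<open>snr\<close> and cancelling \<open>A n\<close> leaves snr \<le> 1 / (T log n).\<close>
    have "A n * snr \<le> A n / (T n * ln (real n))"
      using snr(2) log_density_deriv[OF n2] by (simp add: T_def)
    then have "A n * snr \<le> A n * (1 / (T n * ln (real n)))" by simp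
    then have snr_le: "snr \<le> 1 / (T n * ln (real n))"
      using A_pos[of n] mult_le_cancel_left_pos by blast
    have "(low_deg_corr n (P n) (D n) snr)\<^sup>2 \<le> 2 * T n"
    proof (rule low_deg_corr_sq_le_quantile[where C = C and \<phi> = \<phi> and L = L and C\<^sub>1 = C\<^sub>1])
      show "cumulant n (P n) \<alpha> \<ge> 0" if "\<alpha> \<in> multi_indices n (D n)" for \<alpha>
        using cumulants[OF n2 that] .
      show "(\<integral>x. \<bar>x i\<bar> ^ m \<partial>P n) \<le> (L * real m powr (1 / \<phi>)) ^ m" if "i < n" "m \<ge> 1" for i m
        using sub_weibull_moment_le[OF weibull[OF n2 that(1)] that(2)] by (simp add: L_def)
      show "T n \<ge> real n powr (- C\<^sub>1)" using quantile[OF n2] by (simp add: T_def)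
      show "measure (P n \<Otimes>\<^sub>M P n) {w \<in> space (P n \<Otimes>\<^sub>M P n). \<bar>overlap n w\<bar> > T n}
          \<le> exp (- (real (D n) * (ln (real n))\<^sup>2))"
        using prob_overlap_gt_quantile[OF d] by (simp add: T_def q_def)
    qed (use n snr(1) snr_le D_pos[of n] D_le[OF n2] weibull_consts(1) L C\<^sub>1_pos C_pos in auto)
    \<comment> \<open>Where \<open>\<epsilon> n \<ge> 0\<close>, the level \<open>D' n\<close> is at
      least D log^2 n, and the quantile is monotone in its level.\<close>
    also have "T n \<le> q n (real (D' n))"
    proof -
      have "1 * (real (D n) * (ln (real n))\<^sup>2) \<le> (1 + \<epsilon> n) * (real (D n) * (ln (real n))\<^sup>2)"
        using n d by (intro mult_right_mono) auto
      then show ?thesis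
        unfolding T_def q_def using D'_eq[OF n2] by (intro overlap_quantile_mono d) simp
    qed
    finally show "(low_deg_corr n (P n) (D n) snr)\<^sup>2 \<le> 2 * q n (real (D' n))" by simp
  qed
  have fp: "deriv (fp_ann (p n) u) (q n (real (D n))) = - u - deriv (\<lambda>t. ln (p n t)) (q n (real (D n)))"
    if "n \<ge> 2" for n u
    using deriv_fp_ann[OF density_diff[OF that] density_pos[OF that]] .
  show ?thesis
  proof (intro conjI allI impI)
    show "\<forall>\<^sub>F n in sequentially. \<forall>u>0.
            u + deriv (fp_ann (p n) u) (q n (real (D n))) > 0 \<longrightarrow>
            (low_deg_corr n (P n) (D n)
               (1 / A n * (u + deriv (fp_ann (p n) u) (q n (real (D n))))))\<^sup>2
              \<le> 2 * q n (real (D' n))"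
      using eventually_conj[OF main eventually_ge_at_top[of 2]]
    proof (rule eventually_mono, intro allI impI)
      fix n u
      assume *: "(\<forall>snr. 0 \<le> snr \<longrightarrow> A n * snr \<le> - deriv (\<lambda>t. ln (p n t)) (q n (real (D n))) \<longrightarrow>
          (low_deg_corr n (P n) (D n) snr)\<^sup>2 \<le> 2 * q n (real (D' n))) \<and> 2 \<le> n"
        and u: "u + deriv (fp_ann (p n) u) (q n (real (D n))) > 0"
      let ?s = "1 / A n * (u + deriv (fp_ann (p n) u) (q n (real (D n))))"
      have "0 \<le> ?s" "A n * ?s \<le> - deriv (\<lambda>t. ln (p n t)) (q n (real (D n)))"
        using A_pos[of n] u * fp[of n u] by (simp_all add: divide_le_0_iff)
      then show "(low_deg_corr n (P n) (D n) ?s)\<^sup>2 \<le> 2 * q n (real (D' n))"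
        using * by blast
    qed
  next
    fix snr :: "nat \<Rightarrow> real" assume snr: "\<forall>n. snr n > 0"
    show "\<forall>\<^sub>F n in sequentially. deriv (fp_ann (p n) (snr n)) (q n (real (D n))) \<ge> 0 \<longrightarrow>
            (low_deg_corr n (P n) (D n) (1 / A n * snr n))\<^sup>2 \<le> 2 * q n (real (D' n))"
      using eventually_conj[OF main eventually_ge_at_top[of 2]]
    proof (rule eventually_mono, intro impI)
      fix n
      assume *: "(\<forall>snr. 0 \<le> snr \<longrightarrow> A n * snr \<le> - deriv (\<lambda>t. ln (p n t)) (q n (real (D n))) \<longrightarrow>
          (low_deg_corr n (P n) (D n) snr)\<^sup>2 \<le> 2 * q n (real (D' n))) \<and> 2 \<le> n"
        and "deriv (fp_ann (p n) (snr n)) (q n (real (D n))) \<ge> 0"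
      \<comment> \<open>A nonnegative slope says that \<open>snr n\<close> is at most minus the
        logarithmic derivative, and \<open>A n\<close> times the ratio
        \<open>1 / A n * snr n\<close> is \<open>snr n\<close>.\<close>
      then show "(low_deg_corr n (P n) (D n) (1 / A n * snr n))\<^sup>2 \<le> 2 * q n (real (D' n))"
        using A_pos[of n] snr[rule_format, of n] fp[of n "snr n"] by simp
    qed
  qed
qed

end
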